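(* Assume the van Kampen setup below with $B_k=X_k$ for $k=0,1,2$, and let $P_k:\vec\pi_1(X_k)\to\vec\pi_1(X_k,A_k)$, $k=0,1,2$, be compatible future retracts. Then the commutative square of categories $$\begin{array}{ccc}\vec\pi_1(X_0,A_0)&\xrightarrow{i'_2}&\vec\pi_1(X_2,A_2)\\ \downarrow{\scriptstyle i'_1}&&\downarrow{\scriptstyle j'_2}\\ \vec\pi_1(X_1,A_1)&\xrightarrow{j'_1}&\vec\pi_1(X,A)\end{array}$$ (all functors induced by inclusions) is a pushout in the category of (small) categories.
   Context: A d-space is a topological space with a set of continuous paths $[0,1]\to X$ (dipaths) containing all constant paths, closed under precomposition with continuous non-decreasing maps $[0,1]\to[0,1]$ and under concatenation; subsets carry the dipaths with image in them; a dimap is a continuous map preserving dipaths. $\vec I$ is $[0,1]$ with non-decreasing paths as dipaths. The fundamental category $\vec\pi_1(X)$ has objects the points of $X$ and morphisms $a\to b$ the classes of dipaths from $a$ to $b$ modulo the equivalence relation generated by endpoint-fixing directed homotopies (dimaps $H:\vec I\times\vec I\to X$ with $H(\cdot,0)=\gamma$, $H(\cdot,1)=\gamma'$, $H(0,s)=a$, $H(1,s)=b$); composition is concatenation. For $A\subseteq X$, $\vec\pi_1(X,A)$ is the full subcategory on objects in $A$. Inclusions induce functors. For $A\subseteq B\subseteq X$ with inclusion $\iota:\vec\pi_1(X,A)\to\vec\pi_1(X,B)$, a future retract is a functor $P:\vec\pi_1(X,B)\to\vec\pi_1(X,A)$ left adjoint to $\iota$ whose unit $\eta$ satisfies $\eta_a=\mathrm{id}_a$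 for $a\in A$. Van Kampen setup: $X$ a d-space, $X_1,X_2\subseteq X$ with $X=\mathrm{Int}(X_1)\cup\mathrm{Int}(X_2)$, dipaths of $X$ being the finite concatenations of dipaths of $X_1$ and $X_2$, $X_0=X_1\cap X_2$. For $k=0,1,2$, $A_k\subseteq B_k\subseteq X_k$ with $A_0=A_1\cap A_2$, $B_0=B_1\cap B_2$, $A=A_1\cup A_2$, $B=B_1\cup B_2$, $A=\mathrm{Int}_A(A_1)\cup\mathrm{Int}_A(A_2)$, $B=\mathrm{Int}_B(B_1)\cup\mathrm{Int}_B(B_2)$. Inclusion-induced functors: $i_k:\vec\pi_1(X_0,B_0)\to\vec\pi_1(X_k,B_k)$, $j_k:\vec\pi_1(X_k,B_k)\to\vec\pi_1(X,B)$, $i'_k:\vec\pi_1(X_0,A_0)\to\vec\pi_1(X_k,A_k)$, $j'_k:\vec\pi_1(X_k,A_k)\to\vec\pi_1(X,A)$ ($k=1,2$). Functors $P_k:\vec\pi_1(X_k,B_k)\to\vec\pi_1(X_k,A_k)$ ($k=0,1,2$) are compatible future retracts if each is a future retract with unit $\eta^k$, $P_k\circ i_k=i'_k\circ P_0$ for $k=1,2$, and for each $x\in B_0$ the image of $\eta^0_x$ in $\vec\pi_1(X_k)$ equals $\eta^k_x$. *)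

theory Defs
  imports "HOL-Analysis.Analysis"
begin

text \<open>A d-space is a subset X of a topological type (with the subspace topology)
together with a set D of dipaths. Paths are functions real => 'a, only their values
on [0,1] matter; we therefore require D to be closed under changing a path outside
[0,1] (representation convention).\<close>

definition dspace :: "'a::topological_space set \<Rightarrow> (real \<Rightarrow> 'a) set \<Rightarrow> bool" where
  "dspace X D \<longleftrightarrow>
     (\<forall>\<gamma>\<in>D. path \<gamma> \<and> path_image \<gamma> \<subseteq> X) \<and>
     (\<forall>x\<in>X. (\<lambda>t. x) \<in> D) \<and>
     (\<forall>\<gamma>\<in>D. \<forall>\<phi>. continuous_on {0..1} \<phi> \<and> \<phi> ` {0..1} \<subseteq> {0..1} \<and> mono_on {0..1} \<phi>
                 \<longrightarrow> \<gamma> \<circ> \<phi> \<in> D) \<and>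
     (\<forall>\<gamma>\<in>D. \<forall>\<delta>\<in>D. pathfinish \<gamma> = pathstart \<delta> \<longrightarrow> \<gamma> +++ \<delta> \<in> D) \<and>
     (\<forall>\<gamma>\<in>D. \<forall>\<delta>. (\<forall>t\<in>{0..1}. \<delta> t = \<gamma> t) \<longrightarrow> \<delta> \<in> D)"

definition dip :: "(real \<Rightarrow> 'a::topological_space) set \<Rightarrow> 'a set \<Rightarrow> (real \<Rightarrow> 'a) set" where
  "dip D Y = {\<gamma>\<in>D. path_image \<gamma> \<subseteq> Y}"

definition relint :: "'a::topological_space set \<Rightarrow> 'a set \<Rightarrow> 'a set" where
  "relint S T = \<Union>{U. openin (top_of_set S) U \<and> U \<subseteq> T}"

definition fin_concat :: "((real \<Rightarrow> 'a) \<Rightarrow> bool) \<Rightarrow> (real \<Rightarrow> 'a) \<Rightarrow> bool" where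
  "fin_concat P \<gamma> \<longleftrightarrow>
     (\<exists>n::nat. \<exists>t::nat \<Rightarrow> real. 1 \<le> n \<and> t 0 = 0 \<and> t n = 1 \<and>
        (\<forall>i<n. t i < t (Suc i)) \<and>
        (\<forall>i<n. P (\<lambda>s. \<gamma> (t i + s * (t (Suc i) - t i)))))"

text \<open>Dimaps from I x I (product d-structure: dipaths have both coordinates
non-decreasing) into the subspace Y.\<close>
definition dimap2 :: "(real \<Rightarrow> 'a::topological_space) set \<Rightarrow> 'a set \<Rightarrow> (real \<times> real \<Rightarrow> 'a) \<Rightarrow> bool" where
  "dimap2 D Y H \<longleftrightarrow>
     continuous_on ({0..1} \<times> {0..1}) H \<and> H ` ({0..1} \<times> {0..1}) \<subseteq> Y \<and>
     (\<forall>\<sigma>1 \<sigma>2. path \<sigma>1 \<and> path \<sigma>2 \<and> path_image \<sigma>1 \<subseteq> {0..1} \<and> path_image \<sigma>2 \<subseteq> {0..1} \<and>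
        mono_on {0..1} \<sigma>1 \<and> mono_on {0..1} \<sigma>2 \<longrightarrow> (\<lambda>t. H (\<sigma>1 t, \<sigma>2 t)) \<in> dip D Y)"

definition dhtp :: "(real \<Rightarrow> 'a::topological_space) set \<Rightarrow> 'a set \<Rightarrow> (real \<Rightarrow> 'a) \<Rightarrow> (real \<Rightarrow> 'a) \<Rightarrow> bool" where
  "dhtp D Y \<gamma> \<delta> \<longleftrightarrow>
     (\<exists>H. dimap2 D Y H \<and> (\<forall>t\<in>{0..1}. H (t, 0) = \<gamma> t \<and> H (t, 1) = \<delta> t) \<and>
          (\<forall>s\<in>{0..1}. H (0, s) = \<gamma> 0 \<and> H (1, s) = \<gamma> 1))"

definition dcls :: "(real \<Rightarrow> 'a::topological_space) set \<Rightarrow> 'a set \<Rightarrow> (real \<Rightarrow> 'a) \<Rightarrow> (real \<Rightarrow> 'a) set" where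
  "dcls D Y \<gamma> = {\<delta>. equivclp (dhtp D Y) \<gamma> \<delta>}"

record ('o, 'm) cat =
  Obj :: "'o set"
  Arr :: "'m set"
  Dom :: "'m \<Rightarrow> 'o"
  Cod :: "'m \<Rightarrow> 'o"
  Id  :: "'o \<Rightarrow> 'm"
  Comp :: "'m \<Rightarrow> 'm \<Rightarrow> 'm"   \<comment> \<open>Comp C g f = g o f\<close>

definition hom :: "('o, 'm, 'x) cat_scheme \<Rightarrow> 'o \<Rightarrow> 'o \<Rightarrow> 'm set" where
  "hom C x y = {f \<in> Arr C. Dom C f = x \<and> Cod C f = y}"

definition category :: "('o, 'm, 'x) cat_scheme \<Rightarrow> bool" where
  "category C \<longleftrightarrow>
     (\<forall>f\<in>Arr C. Dom C f \<in> Obj C \<and> Cod C f \<in> Obj C) \<and>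
     (\<forall>x\<in>Obj C. Id C x \<in> hom C x x) \<and>
     (\<forall>f\<in>Arr C. \<forall>g\<in>Arr C. Dom C g = Cod C f \<longrightarrow> Comp C g f \<in> hom C (Dom C f) (Cod C g)) \<and>
     (\<forall>f\<in>Arr C. Comp C (Id C (Cod C f)) f = f \<and> Comp C f (Id C (Dom C f)) = f) \<and>
     (\<forall>f\<in>Arr C. \<forall>g\<in>Arr C. \<forall>h\<in>Arr C. Dom C g = Cod C f \<and> Dom C h = Cod C g \<longrightarrow>
        Comp C h (Comp C g f) = Comp C (Comp C h g) f)"

definition is_functor :: "('o1, 'm1, 'x) cat_scheme \<Rightarrow> ('o2, 'm2, 'y) cat_scheme \<Rightarrow>
                       ('o1 \<Rightarrow> 'o2) \<times> ('m1 \<Rightarrow> 'm2) \<Rightarrow> bool" where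
  "is_functor C E F \<longleftrightarrow>
     (\<forall>x\<in>Obj C. fst F x \<in> Obj E) \<and>
     (\<forall>f\<in>Arr C. snd F f \<in> hom E (fst F (Dom C f)) (fst F (Cod C f))) \<and>
     (\<forall>x\<in>Obj C. snd F (Id C x) = Id E (fst F x)) \<and>
     (\<forall>f\<in>Arr C. \<forall>g\<in>Arr C. Dom C g = Cod C f \<longrightarrow> snd F (Comp C g f) = Comp E (snd F g) (snd F f))"

definition fcomp :: "('o2 \<Rightarrow> 'o3) \<times> ('m2 \<Rightarrow> 'm3) \<Rightarrow> ('o1 \<Rightarrow> 'o2) \<times> ('m1 \<Rightarrow> 'm2) \<Rightarrow>
                     ('o1 \<Rightarrow> 'o3) \<times> ('m1 \<Rightarrow> 'm3)" where
  "fcomp G F = (fst G \<circ> fst F, snd G \<circ> snd F)"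

definition feq :: "('o1, 'm1, 'x) cat_scheme \<Rightarrow> ('o1 \<Rightarrow> 'o2) \<times> ('m1 \<Rightarrow> 'm2) \<Rightarrow>
                   ('o1 \<Rightarrow> 'o2) \<times> ('m1 \<Rightarrow> 'm2) \<Rightarrow> bool" where
  "feq C F G \<longleftrightarrow> (\<forall>x\<in>Obj C. fst F x = fst G x) \<and> (\<forall>f\<in>Arr C. snd F f = snd G f)"

definition pushout_wrt ::
  "('o0, 'm0, 'x0) cat_scheme \<Rightarrow> ('o1, 'm1, 'x1) cat_scheme \<Rightarrow> ('o2, 'm2, 'x2) cat_scheme \<Rightarrow>
   ('o, 'm, 'x) cat_scheme \<Rightarrow>
   ('o0 \<Rightarrow> 'o1) \<times> ('m0 \<Rightarrow> 'm1) \<Rightarrow> ('o0 \<Rightarrow> 'o2) \<times> ('m0 \<Rightarrow> 'm2) \<Rightarrow>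
   ('o1 \<Rightarrow> 'o) \<times> ('m1 \<Rightarrow> 'm) \<Rightarrow> ('o2 \<Rightarrow> 'o) \<times> ('m2 \<Rightarrow> 'm) \<Rightarrow>
   ('oe, 'me, 'xe) cat_scheme \<Rightarrow> bool" where
  "pushout_wrt C0 C1 C2 C i1 i2 j1 j2 E \<longleftrightarrow>
     (\<forall>F1 F2. is_functor C1 E F1 \<and> is_functor C2 E F2 \<and> feq C0 (fcomp F1 i1) (fcomp F2 i2) \<longrightarrow>
        (\<exists>F. is_functor C E F \<and> feq C1 (fcomp F j1) F1 \<and> feq C2 (fcomp F j2) F2 \<and>
             (\<forall>G. is_functor C E G \<and> feq C1 (fcomp G j1) F1 \<and> feq C2 (fcomp G j2) F2 \<longrightarrow> feq C F G)))"

type_synonym 'a dmor = "'a \<times> 'a \<times> (real \<Rightarrow> 'a) set"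

definition rep :: "('a::topological_space) dmor \<Rightarrow> (real \<Rightarrow> 'a)" where
  "rep f = (SOME \<gamma>. \<gamma> \<in> snd (snd f))"

definition fcat :: "(real \<Rightarrow> 'a::topological_space) set \<Rightarrow> 'a set \<Rightarrow> 'a set \<Rightarrow> ('a, 'a dmor) cat" where
  "fcat D Y A = \<lparr> Obj = A,
     Arr = {(a, b, dcls D Y \<gamma>) | a b \<gamma>. a \<in> A \<and> b \<in> A \<and> \<gamma> \<in> dip D Y \<and> \<gamma> 0 = a \<and> \<gamma> 1 = b},
     Dom = fst, Cod = (\<lambda>f. fst (snd f)),
     Id = (\<lambda>a. (a, a, dcls D Y (\<lambda>t. a))),
     Comp = (\<lambda>g f. (fst f, fst (snd g), dcls D Y (rep f +++ rep g))) \<rparr>"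

definition incl :: "(real \<Rightarrow> 'a::topological_space) set \<Rightarrow> 'a set \<Rightarrow> ('a \<Rightarrow> 'a) \<times> ('a dmor \<Rightarrow> 'a dmor)" where
  "incl D Z = (\<lambda>x. x, \<lambda>f. (fst f, fst (snd f), dcls D Z (rep f)))"

text \<open>P : C -> Cs is a future retract with unit eta, where Cs is the full subcategory
of C (so the inclusion functor is the identity on objects and arrows): P is left
adjoint to the inclusion with unit eta, and eta is the identity on objects of Cs.\<close>
definition future_retract ::
  "('o, 'm, 'x) cat_scheme \<Rightarrow> ('o, 'm, 'y) cat_scheme \<Rightarrow> ('o \<Rightarrow> 'o) \<times> ('m \<Rightarrow> 'm) \<Rightarrow> ('o \<Rightarrow> 'm) \<Rightarrow> bool" where
  "future_retract C Cs P \<eta> \<longleftrightarrow>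
     is_functor C Cs P \<and>
     (\<forall>x\<in>Obj C. \<eta> x \<in> hom C x (fst P x)) \<and>
     (\<forall>f\<in>Arr C. Comp C (snd P f) (\<eta> (Dom C f)) = Comp C (\<eta> (Cod C f)) f) \<and>
     (\<forall>x\<in>Obj C. \<forall>a\<in>Obj Cs. \<forall>f\<in>hom C x a.
        \<exists>!g. g \<in> hom Cs (fst P x) a \<and> Comp C g (\<eta> x) = f) \<and>
     (\<forall>a\<in>Obj Cs. \<eta> a = Id C a)"

end

theory Submission
  imports Defs
begin

text \<open>The theorem is deduced from the case \<open>A\<^sub>k = X\<^sub>k\<close>: a retract of a pushout square is a pushout
  square, and the retractions \<open>P\<^sub>k\<close> glue to a functor \<open>R\<close> from \<open>\<pi>\<^sub>1(X)\<close> to \<open>\<pi>\<^sub>1(X, A)\<close>. That \<open>R\<close> is the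
  identity on \<open>\<pi>\<^sub>1(X, A)\<close> follows from the units: they glue to a natural transformation from the
  identity to \<open>R\<close> whose components at points of \<open>A\<close> are identities.

  In the case \<open>A\<^sub>k = X\<^sub>k\<close>, compatible functors on the \<open>\<pi>\<^sub>1(X\<^sub>k)\<close> extend to a dipath by subdividing
  it into segments that lie in one of the \<open>X\<^sub>k\<close>. A directed homotopy is subdivided into rectangles
  with the same property, and these commute.\<close>

section \<open>Functors and retracts of pushouts\<close>

lemma hom_comp: "category C \<Longrightarrow> f \<in> hom C x y \<Longrightarrow> g \<in> hom C y z \<Longrightarrow> Comp C g f \<in> hom C x z"
  unfolding category_def hom_def by force

lemma hom_Id: "category C \<Longrightarrow> x \<in> Obj C \<Longrightarrow> Id C x \<in> hom C x x"
  unfolding category_def by blast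

lemma Comp_Id_left: "category C \<Longrightarrow> f \<in> hom C x y \<Longrightarrow> Comp C (Id C y) f = f"
  and Comp_Id_right: "category C \<Longrightarrow> f \<in> hom C x y \<Longrightarrow> Comp C f (Id C x) = f"
  unfolding category_def hom_def by auto

lemma Comp_assoc:
  "category C \<Longrightarrow> f \<in> hom C x y \<Longrightarrow> g \<in> hom C y z \<Longrightarrow> h \<in> hom C z w \<Longrightarrow>
    Comp C h (Comp C g f) = Comp C (Comp C h g) f"
  unfolding category_def hom_def by auto

lemma commuting_squares_paste:
  assumes C: "category C"
    and top: "f \<in> hom C x y" "g \<in> hom C y z" and bottom: "f' \<in> hom C x' y'" "g' \<in> hom C y' z'"
    and down: "u \<in> hom C x x'" "v \<in> hom C y y'" "w \<in> hom C z z'"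
    and left: "Comp C f' u = Comp C v f" and right: "Comp C g' v = Comp C w g"
  shows "Comp C (Comp C g' f') u = Comp C w (Comp C g f)"
proof -
  have "Comp C (Comp C g' f') u = Comp C g' (Comp C v f)"
    using Comp_assoc[OF C down(1) bottom] left by simp
  also have "\<dots> = Comp C (Comp C w g) f"
    using Comp_assoc[OF C top(1) down(2) bottom(2)] right by simp
  also have "\<dots> = Comp C w (Comp C g f)"
    using Comp_assoc[OF C top down(3)] by simp
  finally show ?thesis .
qed

abbreviation id_functor :: "('o \<Rightarrow> 'o) \<times> ('m \<Rightarrow> 'm)"
  where "id_functor \<equiv> (id, id)"

lemma is_functor_hom: "is_functor C E F \<Longrightarrow> f \<in> hom C x y \<Longrightarrow> snd F f \<in> hom E (fst F x) (fst F y)"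
  and is_functor_Obj: "is_functor C E F \<Longrightarrow> x \<in> Obj C \<Longrightarrow> fst F x \<in> Obj E"
  and is_functor_Id: "is_functor C E F \<Longrightarrow> x \<in> Obj C \<Longrightarrow> snd F (Id C x) = Id E (fst F x)"
  and is_functor_Comp: "is_functor C E F \<Longrightarrow> f \<in> hom C x y \<Longrightarrow> g \<in> hom C y z \<Longrightarrow>
    snd F (Comp C g f) = Comp E (snd F g) (snd F f)"
  unfolding is_functor_def hom_def by auto

lemma is_functor_fcomp: "is_functor C B F \<Longrightarrow> is_functor B E G \<Longrightarrow> is_functor C E (fcomp G F)"
  unfolding is_functor_def fcomp_def hom_def by auto

lemma fcomp_assoc: "fcomp H (fcomp G F) = fcomp (fcomp H G) F"
  by (simp add: fcomp_def comp_assoc)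

lemma fcomp_id_functor [simp]: "fcomp F id_functor = F" "fcomp id_functor F = F"
  by (simp_all add: fcomp_def)

lemma feq_refl [simp]: "feq C F F"
  by (simp add: feq_def)

lemma feq_sym: "feq C F G \<Longrightarrow> feq C G F"
  by (simp add: feq_def)

lemma feq_trans [trans]: "feq C F G \<Longrightarrow> feq C G H \<Longrightarrow> feq C F H"
  by (simp add: feq_def)

lemma feq_fcomp_left: "feq C F G \<Longrightarrow> feq C (fcomp H F) (fcomp H G)"
  by (simp add: feq_def fcomp_def)

lemma feq_fcomp_right: "feq B G H \<Longrightarrow> is_functor C B F \<Longrightarrow> feq C (fcomp G F) (fcomp H F)"
  by (auto simp: feq_def fcomp_def is_functor_def hom_def)

lemma feq_fcomp_square:
  assumes square: "feq C (fcomp R j) (fcomp j' R')" and R': "is_functor C B R'"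
    and F: "feq B (fcomp H j') F"
  shows "feq C (fcomp (fcomp H R) j) (fcomp F R')"
proof -
  have "feq C (fcomp (fcomp H R) j) (fcomp (fcomp H j') R')"
    using feq_fcomp_left[OF square] by (simp flip: fcomp_assoc)
  also have "feq C (fcomp (fcomp H j') R') (fcomp F R')"
    using F R' by (rule feq_fcomp_right)
  finally show ?thesis .
qed

lemma feq_fcomp_retract:
  assumes "feq B (fcomp R S) id_functor"
  shows "feq B (fcomp (fcomp H R) S) H"
  using feq_fcomp_left[OF assms, of H] by (simp flip: fcomp_assoc)

lemma pushout_wrt_retract:
  assumes pushout: "pushout_wrt C0 C1 C2 C i1 i2 j1 j2 E"
    and R: "is_functor C0 B0 R0" "is_functor C1 B1 R1" "is_functor C2 B2 R2" "is_functor C B R"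
    and S: "is_functor B1 C1 S1" "is_functor B2 C2 S2" "is_functor B C S"
    and retract: "feq B1 (fcomp R1 S1) id_functor" "feq B2 (fcomp R2 S2) id_functor"
      "feq B (fcomp R S) id_functor"
    and R_i: "feq C0 (fcomp R1 i1) (fcomp i1' R0)" "feq C0 (fcomp R2 i2) (fcomp i2' R0)"
    and R_j: "feq C1 (fcomp R j1) (fcomp j1' R1)" "feq C2 (fcomp R j2) (fcomp j2' R2)"
    and S_j: "feq B1 (fcomp S j1') (fcomp j1 S1)" "feq B2 (fcomp S j2') (fcomp j2 S2)"
  shows "pushout_wrt B0 B1 B2 B i1' i2' j1' j2' E"
  unfolding pushout_wrt_def
proof (intro allI impI, elim conjE)
  fix F1 F2
  assume F: "is_functor B1 E F1" "is_functor B2 E F2"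
    and F_i: "feq B0 (fcomp F1 i1') (fcomp F2 i2')"
  have "feq C0 (fcomp (fcomp F1 R1) i1) (fcomp (fcomp F2 i2') R0)"
    using R_i(1) R(1) F_i by (rule feq_fcomp_square)
  also have "feq C0 (fcomp (fcomp F2 i2') R0) (fcomp (fcomp F2 R2) i2)"
    using R_i(2) R(1) feq_refl by (rule feq_fcomp_square[THEN feq_sym])
  finally obtain G where G: "is_functor C E G"
    and G_j: "feq C1 (fcomp G j1) (fcomp F1 R1)" "feq C2 (fcomp G j2) (fcomp F2 R2)"
    and unique: "\<And>G'. is_functor C E G' \<Longrightarrow> feq C1 (fcomp G' j1) (fcomp F1 R1) \<Longrightarrow>
      feq C2 (fcomp G' j2) (fcomp F2 R2) \<Longrightarrow> feq C G G'"
    using pushout is_functor_fcomp[OF R(2) F(1)] is_functor_fcomp[OF R(3) F(2)]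
    unfolding pushout_wrt_def by blast
  have GS: "feq B1 (fcomp (fcomp G S) j1') F1" "feq B2 (fcomp (fcomp G S) j2') F2"
    using feq_trans[OF feq_fcomp_square[OF S_j(1) S(1) G_j(1)] feq_fcomp_retract[OF retract(1)]]
      feq_trans[OF feq_fcomp_square[OF S_j(2) S(2) G_j(2)] feq_fcomp_retract[OF retract(2)]] .
  have GS_unique: "feq B (fcomp G S) H"
    if H: "is_functor B E H" "feq B1 (fcomp H j1') F1" "feq B2 (fcomp H j2') F2" for H
  proof -
    have "feq C G (fcomp H R)"
      using is_functor_fcomp[OF R(4) H(1)] feq_fcomp_square[OF R_j(1) R(2) H(2)]
        feq_fcomp_square[OF R_j(2) R(3) H(3)]
      by (rule unique)
    then have "feq B (fcomp G S) (fcomp (fcomp H R) S)"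
      using S(3) by (rule feq_fcomp_right)
    also have "feq B (fcomp (fcomp H R) S) H"
      using retract(3) by (rule feq_fcomp_retract)
    finally show ?thesis .
  qed
  show "\<exists>K. is_functor B E K \<and> feq B1 (fcomp K j1') F1 \<and> feq B2 (fcomp K j2') F2 \<and>
      (\<forall>H. is_functor B E H \<and> feq B1 (fcomp H j1') F1 \<and> feq B2 (fcomp H j2') F2 \<longrightarrow> feq B K H)"
    using is_functor_fcomp[OF S(3) G] GS GS_unique by blast
qed

text \<open>What remains of a future retract when the adjunction is forgotten.\<close>

definition natural_retraction ::
  "('o, 'm, 'x) cat_scheme \<Rightarrow> ('o, 'm, 'y) cat_scheme \<Rightarrow> ('o \<Rightarrow> 'o) \<times> ('m \<Rightarrow> 'm) \<Rightarrow> ('o \<Rightarrow> 'm) \<Rightarrow> bool"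
  where "natural_retraction C B P \<eta> \<longleftrightarrow>
    is_functor C B P \<and>
    (\<forall>x\<in>Obj C. \<eta> x \<in> hom C x (fst P x)) \<and>
    (\<forall>f\<in>Arr C. Comp C (snd P f) (\<eta> (Dom C f)) = Comp C (\<eta> (Cod C f)) f) \<and>
    (\<forall>a\<in>Obj B. \<eta> a = Id C a)"

lemma future_retract_imp_natural_retraction: "future_retract C B P \<eta> \<Longrightarrow> natural_retraction C B P \<eta>"
  by (simp add: future_retract_def natural_retraction_def)

lemma natural_retractionD:
  assumes "natural_retraction C B P \<eta>"
  shows "is_functor C B P"
    and "x \<in> Obj C \<Longrightarrow> \<eta> x \<in> hom C x (fst P x)"
    and "f \<in> hom C x y \<Longrightarrow> Comp C (snd P f) (\<eta> x) = Comp C (\<eta> y) f"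
    and "a \<in> Obj B \<Longrightarrow> \<eta> a = Id C a"
  using assms by (auto simp: natural_retraction_def hom_def)

lemma natural_retraction_id:
  assumes C: "category C" and B: "category B" "is_functor B C id_functor"
    and P: "natural_retraction C B P \<eta>"
  shows "feq B P id_functor"
proof -
  note P = natural_retractionD[OF P]
  have P_obj: "fst P a = a" if "a \<in> Obj B" for a
  proof -
    have "a \<in> Obj C" using is_functor_Obj[OF B(2) that] by simp
    then show ?thesis
      using P(2)[of a] P(4)[OF that] hom_Id[OF C, of a] by (auto simp: hom_def)
  qed
  moreover have "snd P f = f" if "f \<in> Arr B" for f
  proof -
    define a b where "a = Dom B f" and "b = Cod B f"
    have f: "f \<in> hom B a b" and ab: "a \<in> Obj B" "b \<in> Obj B"
      using that B(1) by (auto simp: a_def b_def hom_def category_def)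
    have hom: "f \<in> hom C a b" using is_functor_hom[OF B(2) f] by simp
    then have "snd P f \<in> hom B a b"
      using is_functor_hom[OF P(1), of f a b] P_obj ab by simp
    then have "snd P f \<in> hom C a b" using is_functor_hom[OF B(2)] by fastforce
    then show ?thesis
      using P(3)[OF hom] P(4)[OF ab(1)] P(4)[OF ab(2)] Comp_Id_left[OF C hom] Comp_Id_right[OF C]
      by simp
  qed
  ultimately show ?thesis by (simp add: feq_def)
qed

lemma natural_retraction_image:
  assumes C: "category C" and P: "natural_retraction C B P \<eta>" and B: "is_functor B C id_functor"
    and G: "is_functor C E G" and f: "f \<in> hom C x y"
  shows "Comp E (snd G (snd P f)) (snd G (\<eta> x)) = Comp E (snd G (\<eta> y)) (snd G f)"
proof -
  note P = natural_retractionD[OF P]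
  have xy: "x \<in> Obj C" "y \<in> Obj C" using C f by (auto simp: hom_def category_def)
  have Pf: "snd P f \<in> hom C (fst P x) (fst P y)"
    using is_functor_hom[OF B is_functor_hom[OF P(1) f]] by simp
  have "Comp E (snd G (snd P f)) (snd G (\<eta> x)) = snd G (Comp C (snd P f) (\<eta> x))"
    using is_functor_Comp[OF G P(2)[OF xy(1)] Pf] by simp
  also have "\<dots> = snd G (Comp C (\<eta> y) f)"
    using P(3)[OF f] by simp
  also have "\<dots> = Comp E (snd G (\<eta> y)) (snd G f)"
    using is_functor_Comp[OF G f P(2)[OF xy(2)]] .
  finally show ?thesis .
qed

section \<open>Monotone paths and dimaps\<close>

abbreviation unit_square :: "(real \<times> real) set" where
  "unit_square \<equiv> {0..1} \<times> {0..1}"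

definition mono_paths :: "'b::{topological_space,order} set \<Rightarrow> (real \<Rightarrow> 'b) set" where
  "mono_paths S = {p. path p \<and> path_image p \<subseteq> S \<and> mono_on {0..1} p}"

lemma mono_pathsI:
  assumes "continuous_on {0..1} p" "\<And>t. t \<in> {0..1} \<Longrightarrow> p t \<in> S" "mono_on {0..1} p"
  shows "p \<in> mono_paths S"
  using assms by (auto simp: mono_paths_def path_def path_image_def)

lemma mono_pathsD:
  assumes "p \<in> mono_paths S"
  shows "continuous_on {0..1} p" "t \<in> {0..1} \<Longrightarrow> p t \<in> S" "mono_on {0..1} p"
  using assms by (auto simp: mono_paths_def path_def path_image_def)

lemma mono_paths_const: "x \<in> S \<Longrightarrow> (\<lambda>t. x) \<in> mono_paths S"
  by (intro mono_pathsI mono_onI) auto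

lemma mono_on_joinpaths:
  fixes p q :: "real \<Rightarrow> 'b::{topological_space,order}"
  assumes p: "mono_on {0..1} p" and q: "mono_on {0..1} q" and ends: "p 1 = q 0"
  shows "mono_on {0..1} (p +++ q)"
proof (rule mono_onI)
  fix s t :: real
  assume st: "s \<in> {0..1}" "t \<in> {0..1}" "s \<le> t"
  consider (left) "t \<le> 1/2" | (across) "s \<le> 1/2" "1/2 < t" | (right) "1/2 < s"
    by linarith
  then show "(p +++ q) s \<le> (p +++ q) t"
  proof cases
    case left
    then show ?thesis
      using st mono_onD[OF p, of "2 * s" "2 * t"] by (simp add: joinpaths_def)
  next
    case across
    have "p (2 * s) \<le> p 1"
      using st across by (intro mono_onD[OF p]) auto
    also have "p 1 = q 0" by fact
    also have "q 0 \<le> q (2 * t - 1)"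
      using st across by (intro mono_onD[OF q]) auto
    finally show ?thesis
      using across by (simp add: joinpaths_def)
  next
    case right
    then show ?thesis
      using st mono_onD[OF q, of "2 * s - 1" "2 * t - 1"] by (simp add: joinpaths_def)
  qed
qed

lemma mono_paths_join:
  assumes "p \<in> mono_paths S" "q \<in> mono_paths S" "p 1 = q 0"
  shows "p +++ q \<in> mono_paths S"
  using assms
  by (simp add: mono_paths_def mono_on_joinpaths path_image_join pathfinish_def pathstart_def)

lemma mono_paths_comp:
  assumes p: "p \<in> mono_paths S"
    and r: "continuous_on S r" "\<And>x. x \<in> S \<Longrightarrow> r x \<in> T" "mono_on S r"
  shows "r \<circ> p \<in> mono_paths T"
proof (rule mono_pathsI)
  show "continuous_on {0..1} (r \<circ> p)"
    using mono_pathsD(1,2)[OF p] r(1)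
    by (intro continuous_on_compose continuous_on_subset[OF r(1)]) auto
  show "mono_on {0..1} (r \<circ> p)"
    using mono_pathsD(2,3)[OF p] r(3) by (simp add: mono_on_def)
qed (use mono_pathsD(2)[OF p] r(2) in simp)

lemma linepath_mono_ends:
  fixes a b :: "'b::{real_normed_vector,ordered_real_vector}"
  assumes "a \<le> a'" "b \<le> b'" "s \<in> {0..1}"
  shows "linepath a b s \<le> linepath a' b' s"
  using assms unfolding linepath_def by (intro add_mono scaleR_left_mono) auto

lemma linepath_mono_param:
  fixes a b :: "'b::{real_normed_vector,ordered_real_vector}"
  assumes "a \<le> b" "s \<le> s'"
  shows "linepath a b s \<le> linepath a b s'"
proof -
  have "linepath a b s' - linepath a b s = (s' - s) *\<^sub>R (b - a)"
    by (simp add: linepath_def algebra_simps)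
  also have "0 \<le> \<dots>"
    using assms by (intro scaleR_nonneg_nonneg) auto
  finally show ?thesis by simp
qed

lemma linepath_in_Icc:
  fixes a b :: "'b::{real_normed_vector,ordered_real_vector}"
  assumes "x \<in> {a..b}" "y \<in> {a..b}" "s \<in> {0..1}"
  shows "linepath x y s \<in> {a..b}"
  using linepath_mono_ends[of a x a y s] linepath_mono_ends[of x b y b s] assms by simp

lemma mono_paths_linepath:
  fixes a b :: "'b::{real_normed_vector,ordered_real_vector}"
  assumes "a \<le> b" "{a..b} \<subseteq> S"
  shows "linepath a b \<in> mono_paths S"
proof (rule mono_pathsI)
  show "linepath a b t \<in> S" if "t \<in> {0..1}" for t
    using linepath_in_Icc[of a a b b t] that assms by auto
qed (use assms in \<open>auto intro: mono_onI linepath_mono_param\<close>)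

lemma linepath_real: "linepath a b t = a + t * (b - a)" for a b :: real
  by (simp add: linepath_def algebra_simps)

lemma comp_linepath_0_1 [simp]: "\<gamma> \<circ> linepath 0 1 = \<gamma>" for \<gamma> :: "real \<Rightarrow> 'a"
  by (simp add: fun_eq_iff)

lemma path_image_comp_linepath:
  "u \<le> v \<Longrightarrow> path_image (\<gamma> \<circ> linepath u v) = \<gamma> ` {u..v}" for u v :: real
  unfolding path_image_def image_comp[symmetric] linepath_image_01
  by (simp add: closed_segment_eq_real_ivl)

lemma mono_paths_restrict:
  assumes p: "p \<in> mono_paths S" and uv: "0 \<le> u" "u \<le> v" "v \<le> 1"
    and T: "\<And>t. t \<in> {u..v} \<Longrightarrow> p t \<in> T"
  shows "p \<circ> linepath u v \<in> mono_paths T"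
proof (rule mono_paths_comp)
  show "linepath u v \<in> mono_paths {u..v}"
    using uv by (intro mono_paths_linepath) auto
  show "continuous_on {u..v} p" "mono_on {u..v} p"
    using mono_pathsD[OF p] uv by (auto intro: continuous_on_subset mono_on_subset)
qed (rule T)

lemma mono_paths_sup:
  fixes a b :: "'b::ordered_euclidean_space"
  assumes "p \<in> mono_paths {a..b}" "q \<in> mono_paths {a..b}"
  shows "(\<lambda>t. sup (p t) (q t)) \<in> mono_paths {a..b}"
proof (rule mono_pathsI)
  note p = mono_pathsD[OF assms(1)] and q = mono_pathsD[OF assms(2)]
  show "continuous_on {0..1} (\<lambda>t. sup (p t) (q t))"
    using p(1) q(1) unfolding continuous_on_def by (auto intro: tendsto_sup)
  show "sup (p t) (q t) \<in> {a..b}" if "t \<in> {0..1}" for t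
    using p(2)[OF that] q(2)[OF that] by (simp add: le_supI1)
  show "mono_on {0..1} (\<lambda>t. sup (p t) (q t))"
    by (intro mono_onI sup_mono mono_onD[OF p(3)] mono_onD[OF q(3)])
qed

lemma mono_on_crossing:
  fixes f :: "real \<Rightarrow> real"
  assumes cont: "continuous_on {0..1} f" and mono: "mono_on {0..1} f"
  obtains (below) "\<And>t. t \<in> {0..1} \<Longrightarrow> f t \<le> a"
  | (above) "\<And>t. t \<in> {0..1} \<Longrightarrow> a \<le> f t"
  | (crossing) c where "0 < c" "c < 1"
      "\<And>t. t \<in> {0..c} \<Longrightarrow> f t \<le> a" "\<And>t. t \<in> {c..1} \<Longrightarrow> a \<le> f t"
proof -
  consider "f 1 \<le> a" | "a \<le> f 0" | "f 0 < a" "a < f 1"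
    by linarith
  then show ?thesis
  proof cases
    assume "f 1 \<le> a"
    then have "f t \<le> a" if "t \<in> {0..1}" for t
      using mono_onD[OF mono, of t 1] that by simp
    then show ?thesis by (rule below)
  next
    assume "a \<le> f 0"
    then have "a \<le> f t" if "t \<in> {0..1}" for t
      using mono_onD[OF mono, of 0 t] that by simp
    then show ?thesis by (rule above)
  next
    assume less: "f 0 < a" "a < f 1"
    then obtain c where c: "0 \<le> c" "c \<le> 1" "f c = a"
      using IVT'[of f 0 a 1] cont by auto
    then have "0 < c" "c < 1"
      using less by (auto simp: less_le)
    then show ?thesis
      using mono_onD[OF mono, of _ c] mono_onD[OF mono, of c] c by (intro crossing) auto
  qed
qed

lemma dip_mono: "\<gamma> \<in> dip D Y \<Longrightarrow> Y \<subseteq> Z \<Longrightarrow> \<gamma> \<in> dip D Z"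
  by (auto simp: dip_def)

definition dimap ::
  "(real \<Rightarrow> 'a::topological_space) set \<Rightarrow> 'b::{topological_space,order} set \<Rightarrow> 'a set \<Rightarrow>
    ('b \<Rightarrow> 'a) \<Rightarrow> bool"
  where "dimap D Q Y H \<longleftrightarrow> continuous_on Q H \<and> (\<forall>p\<in>mono_paths Q. H \<circ> p \<in> dip D Y)"

lemma dimap_in:
  assumes "dimap D Q Y H" "x \<in> Q"
  shows "H x \<in> Y"
proof -
  have "H \<circ> (\<lambda>t. x) \<in> dip D Y"
    using assms(1) mono_paths_const[OF assms(2)] unfolding dimap_def by blast
  then show ?thesis by (auto simp: dip_def path_image_def image_subset_iff)
qed

lemma dimap_mono: "dimap D Q Y H \<Longrightarrow> Y \<subseteq> Z \<Longrightarrow> dimap D Q Z H"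
  by (auto simp: dimap_def dip_def)

lemma dimap_restrict:
  assumes H: "dimap D Q Y H" and R: "R \<subseteq> Q" "\<And>x. x \<in> R \<Longrightarrow> H x \<in> Z"
  shows "dimap D R Z H"
proof -
  have "p \<in> mono_paths Q \<and> path_image (H \<circ> p) \<subseteq> Z" if "p \<in> mono_paths R" for p
    using that R by (auto simp: mono_paths_def path_image_def)
  then show ?thesis
    using H R(1) by (auto simp: dimap_def dip_def intro: continuous_on_subset)
qed

lemma dimap_comp:
  assumes H: "dimap D Q Y H"
    and r: "continuous_on R r" "\<And>x. x \<in> R \<Longrightarrow> r x \<in> Q" "mono_on R r"
  shows "dimap D R Y (H \<circ> r)"
proof -
  have "continuous_on R (H \<circ> r)"
    using H r(1,2)
    by (intro continuous_on_compose) (auto simp: dimap_def intro: continuous_on_subset)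
  then show ?thesis
    using H mono_paths_comp[OF _ r] by (auto simp: dimap_def comp_assoc)
qed

lemma dimap2_iff_dimap: "dimap2 D Y H \<longleftrightarrow> dimap D unit_square Y H"
proof
  assume H: "dimap2 D Y H"
  have "H \<circ> p \<in> dip D Y" if p: "p \<in> mono_paths unit_square" for p
  proof -
    have "path (\<lambda>t. fst (p t))" "path (\<lambda>t. snd (p t))"
      unfolding path_def by (intro continuous_intros mono_pathsD(1)[OF p])+
    moreover have "path_image (\<lambda>t. fst (p t)) \<subseteq> {0..1}" "path_image (\<lambda>t. snd (p t)) \<subseteq> {0..1}"
      using p by (fastforce simp: mono_paths_def path_image_def)+
    moreover have "mono_on {0..1} (\<lambda>t. fst (p t))" "mono_on {0..1} (\<lambda>t. snd (p t))"
      using mono_pathsD(3)[OF p] by (auto simp: mono_on_def less_eq_prod_def)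
    ultimately have "(\<lambda>t. H (fst (p t), snd (p t))) \<in> dip D Y"
      using H unfolding dimap2_def by blast
    then show ?thesis by (simp add: comp_def)
  qed
  then show "dimap D unit_square Y H"
    using H by (simp add: dimap_def dimap2_def)
next
  assume H: "dimap D unit_square Y H"
  have "(\<lambda>t. H (\<sigma>1 t, \<sigma>2 t)) \<in> dip D Y"
    if \<sigma>: "\<sigma>1 \<in> mono_paths {0..1}" "\<sigma>2 \<in> mono_paths {0..1}" for \<sigma>1 \<sigma>2
  proof -
    have "(\<lambda>t. (\<sigma>1 t, \<sigma>2 t)) \<in> mono_paths unit_square"
      using mono_pathsD[OF \<sigma>(1)] mono_pathsD[OF \<sigma>(2)]
      by (intro mono_pathsI continuous_intros) (auto simp: mono_on_def)
    then show ?thesis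
      using H by (auto simp: dimap_def comp_def)
  qed
  then show "dimap2 D Y H"
    using H dimap_in[OF H] by (auto simp: dimap_def dimap2_def mono_paths_def)
qed

lemma dimap_row:
  assumes "dimap D unit_square Y H" "s \<in> {0..1}"
  shows "(\<lambda>t. H (t, s)) \<in> dip D Y"
proof -
  have "(\<lambda>t. (t, s)) \<in> mono_paths unit_square"
    using assms(2) by (intro mono_pathsI continuous_intros) (simp_all add: mono_on_def)
  then have "H \<circ> (\<lambda>t. (t, s)) \<in> dip D Y"
    using assms(1) unfolding dimap_def by blast
  then show ?thesis by (simp add: comp_def)
qed

lemma dimap_swap: "dimap D unit_square Y H \<Longrightarrow> dimap D unit_square Y (H \<circ> prod.swap)"
  by (rule dimap_comp) (auto simp: mono_on_def intro: continuous_intros)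

section \<open>Directed homotopies\<close>

lemma dhtpI:
  assumes "dimap D unit_square Y H"
    and "\<And>t. t \<in> {0..1} \<Longrightarrow> H (t, 0) = \<gamma> t" "\<And>t. t \<in> {0..1} \<Longrightarrow> H (t, 1) = \<delta> t"
    and "\<And>s. s \<in> {0..1} \<Longrightarrow> H (0, s) = \<gamma> 0" "\<And>s. s \<in> {0..1} \<Longrightarrow> H (1, s) = \<gamma> 1"
  shows "dhtp D Y \<gamma> \<delta>"
  unfolding dhtp_def dimap2_iff_dimap using assms by blast

lemma dhtpE:
  assumes "dhtp D Y \<gamma> \<delta>"
  obtains H where "dimap D unit_square Y H"
    and "\<And>t. t \<in> {0..1} \<Longrightarrow> H (t, 0) = \<gamma> t" "\<And>t. t \<in> {0..1} \<Longrightarrow> H (t, 1) = \<delta> t"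
    and "\<And>s. s \<in> {0..1} \<Longrightarrow> H (0, s) = \<gamma> 0" "\<And>s. s \<in> {0..1} \<Longrightarrow> H (1, s) = \<gamma> 1"
  using assms unfolding dhtp_def dimap2_iff_dimap by blast

abbreviation dihomotopic ::
  "(real \<Rightarrow> 'a::topological_space) set \<Rightarrow> 'a set \<Rightarrow> (real \<Rightarrow> 'a) \<Rightarrow> (real \<Rightarrow> 'a) \<Rightarrow> bool"
  where "dihomotopic D Y \<equiv> equivclp (dhtp D Y)"

lemma dhtp_mono: "dhtp D Y \<gamma> \<delta> \<Longrightarrow> Y \<subseteq> Z \<Longrightarrow> dhtp D Z \<gamma> \<delta>"
  by (auto elim!: dhtpE intro: dhtpI dimap_mono)

lemma dihomotopic_mono:
  assumes "dihomotopic D Y \<gamma> \<delta>" "Y \<subseteq> Z"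
  shows "dihomotopic D Z \<gamma> \<delta>"
  using assms(1)
proof (induction rule: equivclp_induct)
  case (step \<delta> \<epsilon>)
  then show ?case
    using dhtp_mono[OF _ assms(2)] equivclp_into_equivclp by metis
qed simp

locale directed_space =
  fixes X :: "'a::topological_space set" and D :: "(real \<Rightarrow> 'a) set"
  assumes dspace: "dspace X D"
begin

lemma D_path: "\<gamma> \<in> D \<Longrightarrow> path \<gamma>"
  and D_in_space: "\<gamma> \<in> D \<Longrightarrow> t \<in> {0..1} \<Longrightarrow> \<gamma> t \<in> X"
  and D_const: "x \<in> X \<Longrightarrow> (\<lambda>t. x) \<in> D"
  and D_join: "\<gamma> \<in> D \<Longrightarrow> \<delta> \<in> D \<Longrightarrow> \<gamma> 1 = \<delta> 0 \<Longrightarrow> \<gamma> +++ \<delta> \<in> D"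
  and D_cong: "\<gamma> \<in> D \<Longrightarrow> (\<And>t. t \<in> {0..1} \<Longrightarrow> \<delta> t = \<gamma> t) \<Longrightarrow> \<delta> \<in> D"
  using dspace unfolding dspace_def pathfinish_def pathstart_def path_image_def by blast+

lemma D_reparam: "\<gamma> \<in> D \<Longrightarrow> \<phi> \<in> mono_paths {0..1} \<Longrightarrow> \<gamma> \<circ> \<phi> \<in> D"
  using dspace unfolding dspace_def mono_paths_def path_def path_image_def by blast

lemma dip_space: "dip D X = D"
  using D_in_space by (auto simp: dip_def path_image_def)

lemma dip_in: "\<gamma> \<in> dip D Y \<Longrightarrow> t \<in> {0..1} \<Longrightarrow> \<gamma> t \<in> Y"
  by (auto simp: dip_def path_image_def)

lemma dip_cong: "\<gamma> \<in> dip D Y \<Longrightarrow> (\<And>t. t \<in> {0..1} \<Longrightarrow> \<delta> t = \<gamma> t) \<Longrightarrow> \<delta> \<in> dip D Y"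
  using D_cong by (auto simp: dip_def path_image_def)

lemma dip_const: "x \<in> Y \<Longrightarrow> Y \<subseteq> X \<Longrightarrow> (\<lambda>t. x) \<in> dip D Y"
  using D_const by (auto simp: dip_def path_image_def)

lemma dip_join: "\<gamma> \<in> dip D Y \<Longrightarrow> \<delta> \<in> dip D Y \<Longrightarrow> \<gamma> 1 = \<delta> 0 \<Longrightarrow> \<gamma> +++ \<delta> \<in> dip D Y"
  using D_join by (simp add: dip_def path_image_join pathfinish_def pathstart_def)

lemma dip_restrict:
  assumes "\<gamma> \<in> D" "0 \<le> u" "u \<le> v" "v \<le> 1" "\<gamma> ` {u..v} \<subseteq> Y"
  shows "\<gamma> \<circ> linepath u v \<in> dip D Y"
proof -
  have "\<gamma> \<circ> linepath u v \<in> D"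
    using assms by (intro D_reparam mono_paths_linepath) auto
  then show ?thesis
    using assms by (simp add: dip_def path_image_comp_linepath)
qed

text \<open>Concatenation breaks at \<open>1/2\<close>; the piecewise linear \<open>\<phi>\<close> moves the break to \<open>c\<close>.\<close>

lemma D_of_restrictions:
  assumes c: "0 < c" "c < 1" and init: "\<gamma> \<circ> linepath 0 c \<in> D" and final: "\<gamma> \<circ> linepath c 1 \<in> D"
  shows "\<gamma> \<in> D"
proof -
  define \<phi> where "\<phi> t = min (t / (2 * c)) (1/2) + max 0 ((t - c) / (2 * (1 - c)))" for t
  have low: "\<phi> t = t / (2 * c)" "\<phi> t \<le> 1/2" if "t \<le> c" for t
  proof -
    have "t / (2 * c) \<le> 1/2" "(t - c) / (2 * (1 - c)) \<le> 0"
      using that c by (simp_all add: divide_simps)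
    then show "\<phi> t = t / (2 * c)" "\<phi> t \<le> 1/2" by (simp_all add: \<phi>_def)
  qed
  have high: "\<phi> t = 1/2 + (t - c) / (2 * (1 - c))" "1/2 < \<phi> t" if "c < t" for t
  proof -
    have "1/2 \<le> t / (2 * c)" "0 < (t - c) / (2 * (1 - c))"
      using that c by (simp_all add: divide_simps)
    then show "\<phi> t = 1/2 + (t - c) / (2 * (1 - c))" "1/2 < \<phi> t" by (simp_all add: \<phi>_def)
  qed
  have \<phi>: "\<phi> \<in> mono_paths {0..1}"
  proof (rule mono_pathsI)
    show "continuous_on {0..1} \<phi>"
      unfolding \<phi>_def using c by (intro continuous_intros) auto
    show mono: "mono_on {0..1} \<phi>"
      unfolding \<phi>_def using c by (intro mono_onI add_mono min.mono max.mono divide_right_mono) auto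
    have "\<phi> 0 = 0" "\<phi> 1 = 1" using low(1)[of 0] high(1)[of 1] c by (simp_all add: field_simps)
    then show "\<phi> t \<in> {0..1}" if "t \<in> {0..1}" for t
      using mono_onD[OF mono, of 0 t] mono_onD[OF mono, of t 1] that by auto
  qed
  have "(\<gamma> \<circ> linepath 0 c) +++ (\<gamma> \<circ> linepath c 1) \<in> D"
    using init final by (intro D_join) (simp_all add: linepath_real)
  then have "((\<gamma> \<circ> linepath 0 c) +++ (\<gamma> \<circ> linepath c 1)) \<circ> \<phi> \<in> D"
    using \<phi> by (rule D_reparam)
  then show ?thesis
  proof (rule D_cong)
    fix t :: real
    have "linepath 0 c (2 * \<phi> t) = t" if "t \<le> c"
      using low(1)[OF that] c by (simp add: linepath_real)
    moreover have "linepath c 1 (2 * \<phi> t - 1) = t" if "c < t"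
      using high(1)[OF that] c by (simp add: linepath_real field_simps)
    ultimately show "\<gamma> t = (((\<gamma> \<circ> linepath 0 c) +++ (\<gamma> \<circ> linepath c 1)) \<circ> \<phi>) t"
      using low(2)[of t] high(2)[of t] by (cases "t \<le> c") (auto simp: joinpaths_def)
  qed
qed

lemma dip_of_restrictions:
  assumes "0 < c" "c < 1" "\<gamma> \<circ> linepath 0 c \<in> dip D Y" "\<gamma> \<circ> linepath c 1 \<in> dip D Y"
  shows "\<gamma> \<in> dip D Y"
proof -
  have "path_image \<gamma> = \<gamma> ` {0..c} \<union> \<gamma> ` {c..1}"
    using assms(1,2) by (simp add: path_image_def ivl_disj_un_two_touch flip: image_Un)
  then show ?thesis
    using assms D_of_restrictions by (simp add: dip_def path_image_comp_linepath)
qed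

lemma dimap_dip:
  assumes "\<gamma> \<in> dip D Y"
  shows "dimap D {0..1} Y \<gamma>"
  unfolding dimap_def
proof (intro conjI ballI)
  show "continuous_on {0..1} \<gamma>"
    using assms D_path by (simp add: dip_def path_def)
  fix p :: "real \<Rightarrow> real"
  assume p: "p \<in> mono_paths {0..1}"
  then have "path_image (\<gamma> \<circ> p) \<subseteq> path_image \<gamma>"
    unfolding mono_paths_def path_image_def by auto
  then show "\<gamma> \<circ> p \<in> dip D Y"
    using assms D_reparam[OF _ p] by (auto simp: dip_def)
qed

lemma dimap_cong:
  assumes H: "dimap D Q Y H" and eq: "\<And>x. x \<in> Q \<Longrightarrow> K x = H x"
  shows "dimap D Q Y K"
  unfolding dimap_def
proof (intro conjI ballI)
  show "continuous_on Q K"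
    using H eq continuous_on_cong[of Q Q K H] by (simp add: dimap_def)
  fix p assume p: "p \<in> mono_paths Q"
  then have "H \<circ> p \<in> dip D Y"
    using H by (simp add: dimap_def)
  then show "K \<circ> p \<in> dip D Y"
    by (rule dip_cong) (simp add: eq mono_pathsD(2)[OF p])
qed

lemma dimap_paste:
  fixes h :: "'b::{topological_space,order} \<Rightarrow> real"
  assumes lower: "dimap D {x \<in> Q. h x \<le> a} Y H" and upper: "dimap D {x \<in> Q. a \<le> h x} Y H"
    and h: "continuous_on Q h" "mono_on Q h"
  shows "dimap D Q Y H"
  unfolding dimap_def
proof (intro conjI ballI)
  show "continuous_on Q H"
    using continuous_on_cases_le[of Q h a H H] lower upper h(1) by (simp add: dimap_def)
  fix p assume p: "p \<in> mono_paths Q"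
  have "continuous_on {0..1} (h \<circ> p)" "mono_on {0..1} (h \<circ> p)"
    using mono_pathsD[OF mono_paths_comp[OF p h(1) UNIV_I h(2)]] by simp_all
  then show "H \<circ> p \<in> dip D Y"
  proof (cases rule: mono_on_crossing[where a = a])
    case below
    then have "p \<in> mono_paths {x \<in> Q. h x \<le> a}"
      using mono_paths_restrict[OF p, of 0 1] mono_pathsD(2)[OF p] by simp
    then show ?thesis using lower by (simp add: dimap_def)
  next
    case above
    then have "p \<in> mono_paths {x \<in> Q. a \<le> h x}"
      using mono_paths_restrict[OF p, of 0 1] mono_pathsD(2)[OF p] by simp
    then show ?thesis using upper by (simp add: dimap_def)
  next
    case (crossing c)
    then have "p \<circ> linepath 0 c \<in> mono_paths {x \<in> Q. h x \<le> a}"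
        "p \<circ> linepath c 1 \<in> mono_paths {x \<in> Q. a \<le> h x}"
      using mono_pathsD(2)[OF p] by (auto intro!: mono_paths_restrict[OF p])
    then have "H \<circ> (p \<circ> linepath 0 c) \<in> dip D Y" "H \<circ> (p \<circ> linepath c 1) \<in> dip D Y"
      using lower upper unfolding dimap_def by blast+
    then show ?thesis
      using dip_of_restrictions[of c "H \<circ> p"] crossing by (simp add: comp_assoc)
  qed
qed

lemma dhtp_dip:
  assumes "dhtp D Y \<gamma> \<delta>"
  shows "\<gamma> \<in> dip D Y" "\<delta> \<in> dip D Y" "\<delta> 0 = \<gamma> 0" "\<delta> 1 = \<gamma> 1"
proof -
  obtain H where H: "dimap D unit_square Y H"
    and bottom: "\<And>t. t \<in> {0..1} \<Longrightarrow> H (t, 0) = \<gamma> t" and top: "\<And>t. t \<in> {0..1} \<Longrightarrow> H (t, 1) = \<delta> t"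
    and sides: "\<And>s. s \<in> {0..1} \<Longrightarrow> H (0, s) = \<gamma> 0" "\<And>s. s \<in> {0..1} \<Longrightarrow> H (1, s) = \<gamma> 1"
    using assms by (rule dhtpE) (rule that)
  show "\<gamma> \<in> dip D Y" "\<delta> \<in> dip D Y"
    using dip_cong[OF dimap_row[OF H, of 0]] dip_cong[OF dimap_row[OF H, of 1]] bottom top
    by simp_all
  show "\<delta> 0 = \<gamma> 0" "\<delta> 1 = \<gamma> 1"
    using top[of 0] top[of 1] sides(1)[of 1] sides(2)[of 1] by auto
qed

lemma dihomotopic_dip:
  assumes "dihomotopic D Y \<gamma> \<delta>" "\<gamma> \<in> dip D Y"
  shows "\<delta> \<in> dip D Y" "\<delta> 0 = \<gamma> 0" "\<delta> 1 = \<gamma> 1"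
proof -
  have "\<delta> \<in> dip D Y \<and> \<delta> 0 = \<gamma> 0 \<and> \<delta> 1 = \<gamma> 1"
    using assms(1)
  proof (induction rule: equivclp_induct)
    case (step \<delta> \<epsilon>)
    then show ?case using dhtp_dip by metis
  qed (simp add: assms(2))
  then show "\<delta> \<in> dip D Y" "\<delta> 0 = \<gamma> 0" "\<delta> 1 = \<gamma> 1" by auto
qed

lemma dhtp_comp_of_le:
  fixes a b :: "'b::ordered_euclidean_space"
  assumes H: "dimap D {a..b} Y H" and p: "p \<in> mono_paths {a..b}" and q: "q \<in> mono_paths {a..b}"
    and le: "\<And>t. t \<in> {0..1} \<Longrightarrow> p t \<le> q t" and ends: "p 0 = q 0" "p 1 = q 1"
  shows "dhtp D Y (H \<circ> p) (H \<circ> q)"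
proof -
  define r where "r x = linepath (p (fst x)) (q (fst x)) (snd x)" for x
  have "dimap D unit_square Y (H \<circ> r)"
    using H
  proof (rule dimap_comp)
    have "continuous_on unit_square (\<lambda>x. p (fst x))" "continuous_on unit_square (\<lambda>x. q (fst x))"
      using mono_pathsD(1)[OF p] mono_pathsD(1)[OF q]
      by (auto intro!: continuous_on_compose2[of "{0..1}"] continuous_intros)
    then show "continuous_on unit_square r"
      unfolding r_def linepath_def by (intro continuous_intros)
    show "r x \<in> {a..b}" if "x \<in> unit_square" for x
      unfolding r_def using that mono_pathsD(2)[OF p] mono_pathsD(2)[OF q]
      by (intro linepath_in_Icc) (auto simp: mem_Times_iff)
    show "mono_on unit_square r"
    proof (rule mono_onI)
      fix x y assume "x \<in> unit_square" "y \<in> unit_square" "x \<le> y"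
      then have xy: "fst x \<in> {0..1}" "fst y \<in> {0..1}" "snd x \<in> {0..1}"
        "fst x \<le> fst y" "snd x \<le> snd y"
        by (auto simp: mem_Times_iff less_eq_prod_def)
      then have "r x \<le> linepath (p (fst y)) (q (fst y)) (snd x)"
        unfolding r_def using mono_pathsD(3)[OF p] mono_pathsD(3)[OF q]
        by (intro linepath_mono_ends) (auto simp: mono_on_def)
      also have "\<dots> \<le> r y"
        unfolding r_def using le xy by (intro linepath_mono_param)
      finally show "r x \<le> r y" .
    qed
  qed
  then show ?thesis
    by (rule dhtpI) (simp_all add: r_def linepath_0' linepath_1' ends)
qed

text \<open>Two monotone paths with common ends need not be comparable, but both lie below their
  pointwise supremum.\<close>

lemma dihomotopic_comp:
  fixes a b :: "'b::ordered_euclidean_space"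
  assumes H: "dimap D {a..b} Y H" and p: "p \<in> mono_paths {a..b}" and q: "q \<in> mono_paths {a..b}"
    and ends: "p 0 = q 0" "p 1 = q 1"
  shows "dihomotopic D Y (H \<circ> p) (H \<circ> q)"
proof -
  define r where "r t = sup (p t) (q t)" for t
  have r: "r \<in> mono_paths {a..b}"
    unfolding r_def using p q by (rule mono_paths_sup)
  have "dhtp D Y (H \<circ> p) (H \<circ> r)"
    using H p r by (rule dhtp_comp_of_le) (simp_all add: r_def ends)
  moreover have "dhtp D Y (H \<circ> q) (H \<circ> r)"
    using H q r by (rule dhtp_comp_of_le) (simp_all add: r_def ends)
  ultimately show ?thesis
    by (meson equivclp_trans r_into_equivclp converse_r_into_equivclp)
qed

lemma dhtp_eq_on:
  assumes \<gamma>: "\<gamma> \<in> dip D Y" and eq: "\<And>t. t \<in> {0..1} \<Longrightarrow> \<delta> t = \<gamma> t"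
  shows "dhtp D Y \<gamma> \<delta>"
proof (rule dhtpI)
  show "dimap D unit_square Y (\<gamma> \<circ> fst)"
    using dimap_dip[OF \<gamma>]
    by (rule dimap_comp) (auto simp: mono_on_def less_eq_prod_def intro: continuous_intros)
qed (simp_all add: eq)

lemma dhtp_join:
  assumes \<gamma>: "dhtp D Y \<gamma> \<gamma>'" and \<delta>: "dhtp D Y \<delta> \<delta>'" and ends: "\<gamma> 1 = \<delta> 0"
  shows "dhtp D Y (\<gamma> +++ \<delta>) (\<gamma>' +++ \<delta>')"
proof -
  obtain H where H: "dimap D unit_square Y H"
      "\<And>t. t \<in> {0..1} \<Longrightarrow> H (t, 0) = \<gamma> t" "\<And>t. t \<in> {0..1} \<Longrightarrow> H (t, 1) = \<gamma>' t"
      "\<And>s. s \<in> {0..1} \<Longrightarrow> H (0, s) = \<gamma> 0" "\<And>s. s \<in> {0..1} \<Longrightarrow> H (1, s) = \<gamma> 1"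
    using \<gamma> by (rule dhtpE) (rule that)
  obtain K where K: "dimap D unit_square Y K"
      "\<And>t. t \<in> {0..1} \<Longrightarrow> K (t, 0) = \<delta> t" "\<And>t. t \<in> {0..1} \<Longrightarrow> K (t, 1) = \<delta>' t"
      "\<And>s. s \<in> {0..1} \<Longrightarrow> K (0, s) = \<delta> 0" "\<And>s. s \<in> {0..1} \<Longrightarrow> K (1, s) = \<delta> 1"
    using \<delta> by (rule dhtpE) (rule that)
  define L where
    "L x = (if fst x \<le> 1/2 then H (2 * fst x, snd x) else K (2 * fst x - 1, snd x))" for x
  show ?thesis
  proof (rule dhtpI)
    have "dimap D {x \<in> unit_square. fst x \<le> 1/2} Y (H \<circ> (\<lambda>x. (2 * fst x, snd x)))"
      using H(1) by (rule dimap_comp) (auto simp: mono_on_def intro!: continuous_intros)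
    then have lower: "dimap D {x \<in> unit_square. fst x \<le> 1/2} Y L"
      by (rule dimap_cong) (simp add: L_def)
    have "dimap D {x \<in> unit_square. 1/2 \<le> fst x} Y (K \<circ> (\<lambda>x. (2 * fst x - 1, snd x)))"
      using K(1) by (rule dimap_comp) (auto simp: mono_on_def intro!: continuous_intros)
    moreover have "L x = K (2 * fst x - 1, snd x)" if "x \<in> unit_square" "1/2 \<le> fst x" for x
    proof (cases "fst x = 1/2")
      case True
      then have "2 * fst x = 1" "2 * fst x - 1 = 0" by simp_all
      with True that show ?thesis
        using H(5)[of "snd x"] K(4)[of "snd x"] ends
        by (simp only: L_def) (auto simp: mem_Times_iff)
    next
      case False
      with that show ?thesis by (simp add: L_def)
    qed
    ultimately have upper: "dimap D {x \<in> unit_square. 1/2 \<le> fst x} Y L"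
      by (auto intro: dimap_cong)
    show "dimap D unit_square Y L"
      by (rule dimap_paste[OF lower upper])
        (auto simp: mono_on_def less_eq_prod_def intro: continuous_intros)
  qed (simp_all add: L_def joinpaths_def H K)
qed

lemma dihomotopic_map:
  assumes \<gamma>: "dihomotopic D Y \<gamma> \<gamma>'" "\<gamma> \<in> dip D Y"
    and f: "\<And>\<alpha> \<beta>. dhtp D Y \<alpha> \<beta> \<Longrightarrow> \<alpha> 0 = \<gamma> 0 \<Longrightarrow> \<alpha> 1 = \<gamma> 1 \<Longrightarrow> dhtp D Z (f \<alpha>) (f \<beta>)"
  shows "dihomotopic D Z (f \<gamma>) (f \<gamma>')"
  using \<gamma>(1)
proof (induction rule: equivclp_induct)
  case (step \<alpha> \<beta>)
  have "\<alpha> 0 = \<gamma> 0" "\<alpha> 1 = \<gamma> 1" "\<beta> 0 = \<gamma> 0" "\<beta> 1 = \<gamma> 1"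
    using dihomotopic_dip(2,3)[OF step(1) \<gamma>(2)] step(2) dhtp_dip(3,4) by metis+
  then have "dhtp D Z (f \<alpha>) (f \<beta>) \<or> dhtp D Z (f \<beta>) (f \<alpha>)"
    using step(2) f by blast
  with step.IH show ?case by (meson equivclp_into_equivclp)
qed simp

lemma dihomotopic_join:
  assumes \<gamma>: "dihomotopic D Y \<gamma> \<gamma>'" "\<gamma> \<in> dip D Y" and \<delta>: "dihomotopic D Y \<delta> \<delta>'" "\<delta> \<in> dip D Y"
    and ends: "\<gamma> 1 = \<delta> 0"
  shows "dihomotopic D Y (\<gamma> +++ \<delta>) (\<gamma>' +++ \<delta>')"
proof -
  note refl = dhtp_eq_on[OF _ refl]
  have "dihomotopic D Y (\<gamma> +++ \<delta>) (\<gamma>' +++ \<delta>)"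
    using ends by (intro dihomotopic_map[OF \<gamma>, of _ "\<lambda>\<alpha>. \<alpha> +++ \<delta>"] dhtp_join refl \<delta>(2)) auto
  also have "dihomotopic D Y (\<gamma>' +++ \<delta>) (\<gamma>' +++ \<delta>')"
    using dihomotopic_dip[OF \<gamma>] ends
    by (intro dihomotopic_map[OF \<delta>, of _ "\<lambda>\<alpha>. \<gamma>' +++ \<alpha>"] dhtp_join refl) auto
  finally show ?thesis .
qed

section \<open>The fundamental category\<close>

lemma dihomotopic_restrict_join:
  assumes \<gamma>: "\<gamma> \<in> D" "\<gamma> ` {u..w} \<subseteq> Y" and uvw: "0 \<le> u" "u \<le> v" "v \<le> w" "w \<le> 1"
  shows "dihomotopic D Y ((\<gamma> \<circ> linepath u v) +++ (\<gamma> \<circ> linepath v w)) (\<gamma> \<circ> linepath u w)"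
proof -
  have "dimap D {0..1} X \<gamma>"
    using \<gamma>(1) by (intro dimap_dip) (simp add: dip_space)
  then have "dimap D {u..w} Y \<gamma>"
    by (rule dimap_restrict) (use \<gamma>(2) uvw in auto)
  moreover have "linepath u v +++ linepath v w \<in> mono_paths {u..w}"
    using uvw by (intro mono_paths_join mono_paths_linepath) (auto simp: linepath_0' linepath_1')
  moreover have "linepath u w \<in> mono_paths {u..w}"
    using uvw by (intro mono_paths_linepath) auto
  ultimately have "dihomotopic D Y (\<gamma> \<circ> (linepath u v +++ linepath v w)) (\<gamma> \<circ> linepath u w)"
    by (rule dihomotopic_comp) (simp_all add: joinpaths_def linepath_0' linepath_1')
  then show ?thesis by (simp add: path_compose_join)
qed

lemma dihomotopic_const_join:
  assumes "\<gamma> \<in> dip D Y"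
  shows "dihomotopic D Y ((\<lambda>t. \<gamma> 0) +++ \<gamma>) \<gamma>" "dihomotopic D Y (\<gamma> +++ (\<lambda>t. \<gamma> 1)) \<gamma>"
proof -
  have "\<gamma> \<in> D" "\<gamma> ` {0..1} \<subseteq> Y"
    using assms unfolding dip_def path_image_def by auto
  note join = dihomotopic_restrict_join[OF this]
  show "dihomotopic D Y ((\<lambda>t. \<gamma> 0) +++ \<gamma>) \<gamma>" "dihomotopic D Y (\<gamma> +++ (\<lambda>t. \<gamma> 1)) \<gamma>"
    using join[of 0] join[of 1] by (simp_all add: linepath_refl comp_def)
qed

lemma dihomotopic_join_assoc:
  assumes dip: "\<gamma> \<in> dip D Y" "\<delta> \<in> dip D Y" "\<epsilon> \<in> dip D Y" and ends: "\<gamma> 1 = \<delta> 0" "\<delta> 1 = \<epsilon> 0"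
  shows "dihomotopic D Y (\<gamma> +++ (\<delta> +++ \<epsilon>)) ((\<gamma> +++ \<delta>) +++ \<epsilon>)"
proof -
  define \<kappa> where "\<kappa> = (\<gamma> +++ \<delta>) +++ \<epsilon>"
  define \<phi> where "\<phi> = linepath 0 (1/4) +++ (linepath (1/4) (1/2) +++ linepath (1/2) (1::real))"
  have \<kappa>: "\<kappa> \<in> dip D Y"
    unfolding \<kappa>_def using dip ends by (intro dip_join) (auto simp: joinpaths_def)
  have \<phi>: "\<phi> \<in> mono_paths {0..1}"
    unfolding \<phi>_def
    by (intro mono_paths_join mono_paths_linepath)
      (simp_all add: joinpaths_def linepath_0' linepath_1')
  have pieces: "\<kappa> (linepath 0 (1/4) t) = \<gamma> t" "\<kappa> (linepath (1/4) (1/2) t) = \<delta> t"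
    "\<kappa> (linepath (1/2) 1 t) = \<epsilon> t" if "t \<in> {0..1}" for t
    using that ends by (cases "t = 0"; auto simp: \<kappa>_def joinpaths_def linepath_real field_simps)+
  have "(\<gamma> +++ (\<delta> +++ \<epsilon>)) t = (\<kappa> \<circ> \<phi>) t" if "t \<in> {0..1}" for t
  proof -
    consider "t \<le> 1/2" | "1/2 < t" "t \<le> 3/4" | "3/4 < t" by linarith
    then show ?thesis
      using that pieces(1)[of "2 * t"] pieces(2)[of "2 * (2 * t - 1)"]
        pieces(3)[of "2 * (2 * t - 1) - 1"]
      by cases (simp_all add: \<phi>_def joinpaths_def)
  qed
  moreover have id: "linepath 0 1 \<in> mono_paths {0..1::real}"
    by (intro mono_paths_linepath) auto
  then have "\<kappa> \<circ> \<phi> \<in> dip D Y"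
    using dimap_dip[OF \<kappa>] \<phi> by (simp add: dimap_def)
  ultimately have "dhtp D Y (\<kappa> \<circ> \<phi>) (\<gamma> +++ (\<delta> +++ \<epsilon>))"
    by (intro dhtp_eq_on)
  moreover have "dihomotopic D Y (\<kappa> \<circ> \<phi>) (\<kappa> \<circ> linepath 0 1)"
    using dimap_dip[OF \<kappa>] \<phi> id
    by (rule dihomotopic_comp) (simp_all add: \<phi>_def joinpaths_def linepath_0' linepath_1')
  ultimately show ?thesis
    unfolding \<kappa>_def[symmetric] comp_linepath_0_1 by (meson equivclp_trans converse_r_into_equivclp)
qed

definition mor :: "'a set \<Rightarrow> (real \<Rightarrow> 'a) \<Rightarrow> 'a dmor" where
  "mor Y \<gamma> = (\<gamma> 0, \<gamma> 1, dcls D Y \<gamma>)"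

lemma mor_ends [simp]: "fst (mor Y \<gamma>) = \<gamma> 0" "fst (snd (mor Y \<gamma>)) = \<gamma> 1"
  by (simp_all add: mor_def)

lemma dcls_eq: "dihomotopic D Y \<gamma> \<delta> \<Longrightarrow> dcls D Y \<gamma> = dcls D Y \<delta>"
  unfolding dcls_def by (blast intro: equivclp_trans equivclp_sym)

lemma mor_eq: "dihomotopic D Y \<gamma> \<delta> \<Longrightarrow> \<gamma> \<in> dip D Y \<Longrightarrow> mor Y \<gamma> = mor Y \<delta>"
  using dcls_eq dihomotopic_dip unfolding mor_def by metis

lemma mor_cong: "\<gamma> \<in> dip D Y \<Longrightarrow> (\<And>t. t \<in> {0..1} \<Longrightarrow> \<delta> t = \<gamma> t) \<Longrightarrow> mor Y \<delta> = mor Y \<gamma>"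
  using mor_eq[OF r_into_equivclp[of "dhtp D Y"]] dhtp_eq_on by metis

lemma dihomotopic_rep_mor: "dihomotopic D Y \<gamma> (rep (mor Y \<gamma>))"
proof -
  have "\<gamma> \<in> dcls D Y \<gamma>" by (simp add: dcls_def)
  then have "rep (mor Y \<gamma>) \<in> dcls D Y \<gamma>"
    using someI[of "\<lambda>\<delta>. \<delta> \<in> dcls D Y \<gamma>"] by (simp add: rep_def mor_def)
  then show ?thesis by (simp add: dcls_def)
qed

lemma Obj_fcat [simp]: "Obj (fcat D Y A) = A"
  and Dom_fcat [simp]: "Dom (fcat D Y A) f = fst f"
  and Cod_fcat [simp]: "Cod (fcat D Y A) f = fst (snd f)"
  and Id_fcat: "Id (fcat D Y A) a = mor Y (\<lambda>t. a)"
  by (simp_all add: fcat_def mor_def)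

lemma Arr_fcat: "f \<in> Arr (fcat D Y A) \<longleftrightarrow> (\<exists>\<gamma>\<in>dip D Y. \<gamma> 0 \<in> A \<and> \<gamma> 1 \<in> A \<and> f = mor Y \<gamma>)"
  by (auto simp: fcat_def mor_def)

lemma Arr_fcatE:
  assumes "f \<in> Arr (fcat D Y A)"
  obtains \<gamma> where "\<gamma> \<in> dip D Y" "\<gamma> 0 \<in> A" "\<gamma> 1 \<in> A" "f = mor Y \<gamma>"
  using assms Arr_fcat by blast

lemma mor_hom_fcat:
  "\<gamma> \<in> dip D Y \<Longrightarrow> \<gamma> 0 \<in> A \<Longrightarrow> \<gamma> 1 \<in> A \<Longrightarrow> mor Y \<gamma> \<in> hom (fcat D Y A) (\<gamma> 0) (\<gamma> 1)"
  by (auto simp: hom_def Arr_fcat)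

lemma mor_hom_fcat_self: "\<gamma> \<in> dip D Y \<Longrightarrow> mor Y \<gamma> \<in> hom (fcat D Y Y) (\<gamma> 0) (\<gamma> 1)"
  by (intro mor_hom_fcat dip_in) auto

lemma Comp_fcat:
  assumes "\<gamma> \<in> dip D Y" "\<delta> \<in> dip D Y" "\<gamma> 1 = \<delta> 0"
  shows "Comp (fcat D Y A) (mor Y \<delta>) (mor Y \<gamma>) = mor Y (\<gamma> +++ \<delta>)"
proof -
  have "dihomotopic D Y (\<gamma> +++ \<delta>) (rep (mor Y \<gamma>) +++ rep (mor Y \<delta>))"
    using assms by (intro dihomotopic_join dihomotopic_rep_mor)
  then have "dcls D Y (rep (mor Y \<gamma>) +++ rep (mor Y \<delta>)) = dcls D Y (\<gamma> +++ \<delta>)"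
    using dcls_eq by metis
  then show ?thesis
    by (simp add: fcat_def) (simp add: mor_def joinpaths_def)
qed

lemma category_fcat:
  assumes "A \<subseteq> Y" "Y \<subseteq> X"
  shows "category (fcat D Y A)" (is "category ?C")
  unfolding category_def
proof (intro conjI ballI impI)
  fix f assume "f \<in> Arr ?C"
  then obtain \<gamma> where f: "\<gamma> \<in> dip D Y" "\<gamma> 0 \<in> A" "\<gamma> 1 \<in> A" "f = mor Y \<gamma>"
    by (rule Arr_fcatE)
  show "Dom ?C f \<in> Obj ?C" "Cod ?C f \<in> Obj ?C"
    using f by auto
  have const: "(\<lambda>t. \<gamma> 0) \<in> dip D Y" "(\<lambda>t. \<gamma> 1) \<in> dip D Y"
    using f assms by (auto intro: dip_const)
  then have "mor Y ((\<lambda>t. \<gamma> 0) +++ \<gamma>) = mor Y \<gamma>" "mor Y (\<gamma> +++ (\<lambda>t. \<gamma> 1)) = mor Y \<gamma>"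
    using f by (auto intro!: mor_eq dihomotopic_const_join dip_join)
  then show "Comp ?C (Id ?C (Cod ?C f)) f = f" "Comp ?C f (Id ?C (Dom ?C f)) = f"
    using const f by (simp_all add: Id_fcat Comp_fcat)
next
  fix x assume "x \<in> Obj ?C"
  then show "Id ?C x \<in> hom ?C x x"
    using assms mor_hom_fcat[OF dip_const, of x Y A] by (auto simp: Id_fcat)
next
  fix f g assume "f \<in> Arr ?C" "g \<in> Arr ?C" and composable: "Dom ?C g = Cod ?C f"
  then obtain \<gamma> \<delta> where f: "\<gamma> \<in> dip D Y" "\<gamma> 0 \<in> A" "\<gamma> 1 \<in> A" "f = mor Y \<gamma>"
    and g: "\<delta> \<in> dip D Y" "\<delta> 0 \<in> A" "\<delta> 1 \<in> A" "g = mor Y \<delta>"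
    by (elim Arr_fcatE)
  have ends: "\<gamma> 1 = \<delta> 0" "(\<gamma> +++ \<delta>) 0 = \<gamma> 0" "(\<gamma> +++ \<delta>) 1 = \<delta> 1"
    using composable f g by (auto simp: joinpaths_def)
  then show "Comp ?C g f \<in> hom ?C (Dom ?C f) (Cod ?C g)"
    using f g mor_hom_fcat[of "\<gamma> +++ \<delta>"] dip_join[of \<gamma> Y \<delta>] by (simp add: Comp_fcat)
next
  fix f g h assume "f \<in> Arr ?C" "g \<in> Arr ?C" "h \<in> Arr ?C"
    and composable: "Dom ?C g = Cod ?C f \<and> Dom ?C h = Cod ?C g"
  then obtain \<gamma> \<delta> \<epsilon> where dip: "\<gamma> \<in> dip D Y" "\<delta> \<in> dip D Y" "\<epsilon> \<in> dip D Y"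
    and mor: "f = mor Y \<gamma>" "g = mor Y \<delta>" "h = mor Y \<epsilon>"
    by (elim Arr_fcatE)
  then have ends: "\<gamma> 1 = \<delta> 0" "\<delta> 1 = \<epsilon> 0" "(\<gamma> +++ \<delta>) 1 = \<delta> 1" "(\<delta> +++ \<epsilon>) 0 = \<delta> 0"
    using composable by (simp_all add: joinpaths_def)
  then have "\<gamma> +++ \<delta> \<in> dip D Y" "\<delta> +++ \<epsilon> \<in> dip D Y"
    "mor Y (\<gamma> +++ (\<delta> +++ \<epsilon>)) = mor Y ((\<gamma> +++ \<delta>) +++ \<epsilon>)"
    using dip by (auto intro!: mor_eq dihomotopic_join_assoc dip_join)
  then show "Comp ?C h (Comp ?C g f) = Comp ?C (Comp ?C h g) f"
    using dip mor ends by (simp add: Comp_fcat)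
qed

lemma is_functor_fcatI:
  assumes "\<And>x. x \<in> A \<Longrightarrow> fst F x \<in> Obj E"
    and "\<And>\<gamma>. \<gamma> \<in> dip D Y \<Longrightarrow> \<gamma> 0 \<in> A \<Longrightarrow> \<gamma> 1 \<in> A \<Longrightarrow>
      snd F (mor Y \<gamma>) \<in> hom E (fst F (\<gamma> 0)) (fst F (\<gamma> 1))"
    and "\<And>x. x \<in> A \<Longrightarrow> snd F (mor Y (\<lambda>t. x)) = Id E (fst F x)"
    and "\<And>\<gamma> \<delta>. \<gamma> \<in> dip D Y \<Longrightarrow> \<delta> \<in> dip D Y \<Longrightarrow> \<gamma> 1 = \<delta> 0 \<Longrightarrow> \<gamma> 0 \<in> A \<Longrightarrow> \<delta> 0 \<in> A \<Longrightarrow> \<delta> 1 \<in> A \<Longrightarrow>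
      snd F (mor Y (\<gamma> +++ \<delta>)) = Comp E (snd F (mor Y \<delta>)) (snd F (mor Y \<gamma>))"
  shows "is_functor (fcat D Y A) E F"
  using assms unfolding is_functor_def by (auto simp: Id_fcat Comp_fcat elim!: Arr_fcatE)

lemma is_functor_fcatD:
  assumes F: "is_functor (fcat D Y Y) E F"
  shows "\<gamma> \<in> dip D Y \<Longrightarrow> snd F (mor Y \<gamma>) \<in> hom E (fst F (\<gamma> 0)) (fst F (\<gamma> 1))"
    and "x \<in> Y \<Longrightarrow> snd F (mor Y (\<lambda>t. x)) = Id E (fst F x)"
    and "\<gamma> \<in> dip D Y \<Longrightarrow> \<delta> \<in> dip D Y \<Longrightarrow> \<gamma> 1 = \<delta> 0 \<Longrightarrow>
      snd F (mor Y (\<gamma> +++ \<delta>)) = Comp E (snd F (mor Y \<delta>)) (snd F (mor Y \<gamma>))"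
proof -
  show "snd F (mor Y \<gamma>) \<in> hom E (fst F (\<gamma> 0)) (fst F (\<gamma> 1))" if "\<gamma> \<in> dip D Y"
    using is_functor_hom[OF F mor_hom_fcat_self[OF that]] .
  show "snd F (mor Y (\<lambda>t. x)) = Id E (fst F x)" if "x \<in> Y"
    using is_functor_Id[OF F, of x] that by (simp add: Id_fcat)
  show "snd F (mor Y (\<gamma> +++ \<delta>)) = Comp E (snd F (mor Y \<delta>)) (snd F (mor Y \<gamma>))"
    if "\<gamma> \<in> dip D Y" "\<delta> \<in> dip D Y" "\<gamma> 1 = \<delta> 0"
    using is_functor_Comp[OF F mor_hom_fcat_self[OF that(1)], of "mor Y \<delta>" "\<delta> 1"]
      mor_hom_fcat_self[OF that(2)] that
    by (simp add: Comp_fcat)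
qed

lemma is_functor_id_fcat:
  assumes "A \<subseteq> B"
  shows "is_functor (fcat D Y A) (fcat D Y B) id_functor"
  using assms by (intro is_functor_fcatI) (auto simp: Id_fcat Comp_fcat intro: mor_hom_fcat)

lemma incl_obj [simp]: "fst (incl D Z) x = x"
  by (simp add: incl_def)

lemma incl_mor:
  assumes "\<gamma> \<in> dip D Y" "Y \<subseteq> Z"
  shows "snd (incl D Z) (mor Y \<gamma>) = mor Z \<gamma>"
proof -
  have "dcls D Z (rep (mor Y \<gamma>)) = dcls D Z \<gamma>"
    using dcls_eq[OF dihomotopic_mono[OF dihomotopic_rep_mor assms(2)]] by metis
  then show ?thesis by (simp add: incl_def) (simp add: mor_def)
qed

lemma is_functor_incl:
  assumes "A \<subseteq> Y" "Y \<subseteq> Z" "Z \<subseteq> X" "A \<subseteq> B"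
  shows "is_functor (fcat D Y A) (fcat D Z B) (incl D Z)"
proof (rule is_functor_fcatI)
  note dip = dip_mono[OF _ \<open>Y \<subseteq> Z\<close>] and mor = incl_mor[OF _ \<open>Y \<subseteq> Z\<close>]
  show "fst (incl D Z) x \<in> Obj (fcat D Z B)" if "x \<in> A" for x
    using that assms by auto
  show "snd (incl D Z) (mor Y \<gamma>) \<in> hom (fcat D Z B) (fst (incl D Z) (\<gamma> 0)) (fst (incl D Z) (\<gamma> 1))"
    if "\<gamma> \<in> dip D Y" "\<gamma> 0 \<in> A" "\<gamma> 1 \<in> A" for \<gamma>
    using that assms mor_hom_fcat[OF dip, of \<gamma> B] by (auto simp: mor)
  show "snd (incl D Z) (mor Y (\<lambda>t. x)) = Id (fcat D Z B) (fst (incl D Z) x)" if "x \<in> A" for x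
    using that assms dip_const[of x Y] by (auto simp: mor Id_fcat)
  show "snd (incl D Z) (mor Y (\<gamma> +++ \<delta>))
      = Comp (fcat D Z B) (snd (incl D Z) (mor Y \<delta>)) (snd (incl D Z) (mor Y \<gamma>))"
    if "\<gamma> \<in> dip D Y" "\<delta> \<in> dip D Y" "\<gamma> 1 = \<delta> 0" for \<gamma> \<delta>
    using that by (simp add: mor dip dip_join Comp_fcat)
qed

lemma incl_incl:
  assumes "f \<in> Arr (fcat D Y A)" "Y \<subseteq> Z" "Z \<subseteq> W"
  shows "snd (incl D W) (snd (incl D Z) f) = snd (incl D W) f"
proof -
  obtain \<gamma> where "\<gamma> \<in> dip D Y" "f = mor Y \<gamma>" using assms(1) by (rule Arr_fcatE)
  then show ?thesis
    using assms(2,3) by (simp add: incl_mor dip_mono incl_mor[OF _ subset_trans])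
qed

lemma feq_incl_incl:
  assumes "Y \<subseteq> Z" "Z \<subseteq> W"
  shows "feq (fcat D Y A) (fcomp (incl D W) (incl D Z)) (incl D W)"
  using incl_incl[OF _ assms] by (simp add: feq_def fcomp_def)

lemma natural_retraction_fcat_id:
  assumes "natural_retraction (fcat D Y Y) (fcat D Y A) P \<eta>" "A \<subseteq> Y" "Y \<subseteq> X"
  shows "feq (fcat D Y A) P id_functor"
  using assms
  by (intro natural_retraction_id[of "fcat D Y Y"] category_fcat is_functor_id_fcat) auto

end

section \<open>Covered d-spaces\<close>

lemma openin_relint: "openin (top_of_set S) (relint S T)"
  unfolding relint_def by (rule openin_Union) blast

lemma relint_subset: "relint S T \<subseteq> T"
  unfolding relint_def by blast

lemma Bolzano_unit_interval [case_names trans local]: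
  fixes P :: "real \<Rightarrow> real \<Rightarrow> bool"
  assumes trans: "\<And>a b c. 0 \<le> a \<Longrightarrow> a \<le> b \<Longrightarrow> b \<le> c \<Longrightarrow> c \<le> 1 \<Longrightarrow> P a b \<Longrightarrow> P b c \<Longrightarrow> P a c"
    and local: "\<And>x. 0 \<le> x \<Longrightarrow> x \<le> 1 \<Longrightarrow>
      \<exists>d>0. \<forall>a b. 0 \<le> a \<and> a \<le> x \<and> x \<le> b \<and> b \<le> 1 \<and> b - a < d \<longrightarrow> P a b"
  shows "P 0 1"
proof -
  define Q where "Q a b \<longleftrightarrow> (0 \<le> a \<and> b \<le> 1 \<longrightarrow> P a b)" for a b
  have "Q 0 1"
  proof (rule Bolzano[of 0 1 Q])
    show "Q a c" if "Q a b" "Q b c" "a \<le> b" "b \<le> c" for a b c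
      using that trans[of a b c] by (auto simp: Q_def)
    show "\<exists>d>0. \<forall>a b. a \<le> x \<and> x \<le> b \<and> b - a < d \<longrightarrow> Q a b" if "0 \<le> x" "x \<le> 1" for x
      using local[OF that] unfolding Q_def by blast
  qed simp
  then show ?thesis by (simp add: Q_def)
qed

locale covered_space = directed_space X D
  for X :: "'a::topological_space set" and D +
  fixes Y :: "'i \<Rightarrow> 'a set"
  assumes piece_subset: "Y i \<subseteq> X" and cover: "X = (\<Union>i. relint X (Y i))"
begin

lemma in_piece:
  assumes "x \<in> X"
  obtains i where "x \<in> Y i"
  using assms cover relint_subset by blast

lemma continuous_locally_in_piece:
  assumes H: "continuous_on unit_square H" "H ` unit_square \<subseteq> X" and xy: "(x, y) \<in> unit_square"
  obtains d i where "0 < d"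
    "\<And>s t. (s, t) \<in> unit_square \<Longrightarrow> \<bar>s - x\<bar> < d \<Longrightarrow> \<bar>t - y\<bar> < d \<Longrightarrow> H (s, t) \<in> Y i"
proof -
  obtain i where i: "H (x, y) \<in> relint X (Y i)"
    using H(2) xy cover by blast
  have "openin (top_of_set unit_square) (unit_square \<inter> H -` relint X (Y i))"
    using H by (intro continuous_openin_preimage[OF _ _ openin_relint]) auto
  then obtain G where G: "open G" "unit_square \<inter> H -` relint X (Y i) = unit_square \<inter> G"
    unfolding openin_open by blast
  then obtain e where e: "0 < e" "ball (x, y) e \<subseteq> G"
    using i xy open_contains_ball by blast
  have "H (s, t) \<in> Y i" if "(s, t) \<in> unit_square" "\<bar>s - x\<bar> < e/2" "\<bar>t - y\<bar> < e/2" for s t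
  proof -
    have "dist (s, t) (x, y) \<le> \<bar>s - x\<bar> + \<bar>t - y\<bar>"
      using sqrt_sum_squares_le_sum_abs[of "s - x" "t - y"]
      by (simp add: dist_Pair_Pair dist_real_def)
    then have "(s, t) \<in> ball (x, y) e" using that by (simp add: dist_commute)
    then show ?thesis using e(2) G(2) that(1) relint_subset by blast
  qed
  with e(1) show ?thesis by (intro that[of "e/2"]) auto
qed

lemma rectangle_induct [consumes 2, case_names small horizontal vertical]:
  assumes H: "continuous_on unit_square H" "H ` unit_square \<subseteq> X"
    and small: "\<And>a a' b b' i. 0 \<le> a \<Longrightarrow> a \<le> a' \<Longrightarrow> a' \<le> 1 \<Longrightarrow> 0 \<le> b \<Longrightarrow> b \<le> b' \<Longrightarrow> b' \<le> 1 \<Longrightarrow>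
      H ` ({a..a'} \<times> {b..b'}) \<subseteq> Y i \<Longrightarrow> P a a' b b'"
    and horizontal: "\<And>a a' a'' b b'. 0 \<le> a \<Longrightarrow> a \<le> a' \<Longrightarrow> a' \<le> a'' \<Longrightarrow> a'' \<le> 1 \<Longrightarrow>
      0 \<le> b \<Longrightarrow> b \<le> b' \<Longrightarrow> b' \<le> 1 \<Longrightarrow> P a a' b b' \<Longrightarrow> P a' a'' b b' \<Longrightarrow> P a a'' b b'"
    and vertical: "\<And>a a' b b' b''. 0 \<le> a \<Longrightarrow> a \<le> a' \<Longrightarrow> a' \<le> 1 \<Longrightarrow>
      0 \<le> b \<Longrightarrow> b \<le> b' \<Longrightarrow> b' \<le> b'' \<Longrightarrow> b'' \<le> 1 \<Longrightarrow> P a a' b b' \<Longrightarrow> P a a' b' b'' \<Longrightarrow> P a a' b b''"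
  shows "P 0 1 0 1"
proof (rule Bolzano_unit_interval[of "P 0 1"])
  show "P 0 1 b b''"
    if "0 \<le> b" "b \<le> b'" "b' \<le> b''" "b'' \<le> 1" "P 0 1 b b'" "P 0 1 b' b''" for b b' b''
    using that by (intro vertical[of 0 1 b b' b'']) auto
next
  fix y :: real
  assume y: "0 \<le> y" "y \<le> 1"
  define near where "near d b b' \<longleftrightarrow> 0 \<le> b \<and> b \<le> y \<and> y \<le> b' \<and> b' \<le> 1 \<and> b' - b < d" for d b b'
  define strip where "strip a a' \<longleftrightarrow> (\<exists>d>0. \<forall>b b'. near d b b' \<longrightarrow> P a a' b b')" for a a'
  have "strip 0 1"
  proof (rule Bolzano_unit_interval[of strip])
    fix a a' a''
    assume le: "0 \<le> a" "a \<le> a'" "a' \<le> a''" "a'' \<le> 1" and "strip a a'" "strip a' a''"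
    then obtain d e where "0 < d" "\<And>b b'. near d b b' \<Longrightarrow> P a a' b b'"
      and "0 < e" "\<And>b b'. near e b b' \<Longrightarrow> P a' a'' b b'"
      unfolding strip_def by blast
    with le show "strip a a''"
      unfolding strip_def by (intro exI[of _ "min d e"]) (auto simp: near_def intro: horizontal)
  next
    fix x :: real
    assume "0 \<le> x" "x \<le> 1"
    with H y obtain d i where d: "0 < d"
      and in_Y: "\<And>s t. (s, t) \<in> unit_square \<Longrightarrow> \<bar>s - x\<bar> < d \<Longrightarrow> \<bar>t - y\<bar> < d \<Longrightarrow> H (s, t) \<in> Y i"
      by (elim continuous_locally_in_piece[of H x y]) auto
    have "P a a' b b'"
      if "0 \<le> a" "a \<le> x" "x \<le> a'" "a' \<le> 1" "a' - a < d" "near d b b'" for a a' b b'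
      using that by (intro small[of a a' b b' i]) (auto simp: near_def intro!: in_Y)
    with d show "\<exists>d>0. \<forall>a a'. 0 \<le> a \<and> a \<le> x \<and> x \<le> a' \<and> a' \<le> 1 \<and> a' - a < d \<longrightarrow> strip a a'"
      unfolding strip_def by blast
  qed
  then show "\<exists>d>0. \<forall>b b'. 0 \<le> b \<and> b \<le> y \<and> y \<le> b' \<and> b' \<le> 1 \<and> b' - b < d \<longrightarrow> P 0 1 b b'"
    by (simp add: strip_def near_def)
qed

lemma segment_induct [consumes 1, case_names small join]:
  assumes \<gamma>: "\<gamma> \<in> D"
    and small: "\<And>u v i. 0 \<le> u \<Longrightarrow> u \<le> v \<Longrightarrow> v \<le> 1 \<Longrightarrow> \<gamma> ` {u..v} \<subseteq> Y i \<Longrightarrow> P u v"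
    and join: "\<And>u v w. 0 \<le> u \<Longrightarrow> u \<le> v \<Longrightarrow> v \<le> w \<Longrightarrow> w \<le> 1 \<Longrightarrow> P u v \<Longrightarrow> P v w \<Longrightarrow> P u w"
  shows "P 0 1"
proof (rule rectangle_induct[of "\<gamma> \<circ> fst" "\<lambda>a a' _ _. P a a'"])
  show "continuous_on unit_square (\<gamma> \<circ> fst)"
    using D_path[OF \<gamma>] unfolding path_def
    by (intro continuous_on_compose continuous_intros) auto
  show "(\<gamma> \<circ> fst) ` unit_square \<subseteq> X"
    using D_in_space[OF \<gamma>] by auto
  show "P a a'" if "0 \<le> a" "a \<le> a'" "a' \<le> 1" "b \<le> b'" "(\<gamma> \<circ> fst) ` ({a..a'} \<times> {b..b'}) \<subseteq> Y i"
    for a a' b b' :: real and i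
  proof (rule small[OF that(1-3)])
    have "\<gamma> ` {a..a'} = (\<gamma> \<circ> fst) ` ({a..a'} \<times> {b..b'})"
      unfolding image_comp[symmetric] fst_image_times using that(4) by auto
    then show "\<gamma> ` {a..a'} \<subseteq> Y i" using that(5) by (simp only:)
  qed
qed (auto intro: join)

lemma arrow_induct [consumes 1, case_names small comp]:
  assumes f: "f \<in> Arr (fcat D X X)"
    and small: "\<And>i f. f \<in> Arr (fcat D (Y i) (Y i)) \<Longrightarrow> Q (snd (incl D X) f)"
    and comp: "\<And>f g x y z. f \<in> hom (fcat D X X) x y \<Longrightarrow> g \<in> hom (fcat D X X) y z \<Longrightarrow>
      Q f \<Longrightarrow> Q g \<Longrightarrow> Q (Comp (fcat D X X) g f)"
  shows "Q f"
proof -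
  obtain \<gamma> where \<gamma>: "\<gamma> \<in> D" "f = mor X \<gamma>"
    using f by (auto simp: dip_space elim: Arr_fcatE)
  have "Q (mor X (\<gamma> \<circ> linepath 0 1))"
    using \<gamma>(1)
  proof (induction rule: segment_induct)
    case (small u v i)
    then have dip: "\<gamma> \<circ> linepath u v \<in> dip D (Y i)"
      using \<gamma>(1) by (intro dip_restrict)
    then have "Q (snd (incl D X) (mor (Y i) (\<gamma> \<circ> linepath u v)))"
      using mor_hom_fcat_self by (intro assms(2)) (simp add: hom_def)
    then show ?case by (simp only: incl_mor[OF dip piece_subset])
  next
    case (join u v w)
    define \<alpha> \<beta> where "\<alpha> = \<gamma> \<circ> linepath u v" and "\<beta> = \<gamma> \<circ> linepath v w"
    have image: "\<gamma> ` {s..t} \<subseteq> X" if "0 \<le> s" "t \<le> 1" for s t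
      using that D_in_space[OF \<gamma>(1)] by auto
    have dip: "\<alpha> \<in> dip D X" "\<beta> \<in> dip D X"
      unfolding \<alpha>_def \<beta>_def using join by (auto intro!: dip_restrict[OF \<gamma>(1) _ _ _ image])
    have ends: "\<alpha> 1 = \<beta> 0"
      by (simp add: \<alpha>_def \<beta>_def linepath_0' linepath_1')
    have "dihomotopic D X (\<alpha> +++ \<beta>) (\<gamma> \<circ> linepath u w)"
      unfolding \<alpha>_def \<beta>_def using join by (intro dihomotopic_restrict_join[OF \<gamma>(1) image]) auto
    then have "mor X (\<gamma> \<circ> linepath u w) = Comp (fcat D X X) (mor X \<beta>) (mor X \<alpha>)"
      using mor_eq[OF _ dip_join[OF dip ends]] Comp_fcat[OF dip ends] by simp
    moreover have "mor X \<alpha> \<in> hom (fcat D X X) (\<alpha> 0) (\<alpha> 1)" "mor X \<beta> \<in> hom (fcat D X X) (\<alpha> 1) (\<beta> 1)"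
      using mor_hom_fcat_self[OF dip(1)] mor_hom_fcat_self[OF dip(2)] ends by simp_all
    ultimately show ?case
      using comp join.IH unfolding \<alpha>_def \<beta>_def by metis
  qed
  then show ?thesis using \<gamma>(2) by simp
qed

lemma feq_fcat_of_pieces:
  assumes F: "is_functor (fcat D X X) E F" and G: "is_functor (fcat D X X) E G"
    and pieces: "\<And>i. feq (fcat D (Y i) (Y i)) (fcomp F (incl D X)) (fcomp G (incl D X))"
  shows "feq (fcat D X X) F G"
proof -
  have "snd F f = snd G f" if "f \<in> Arr (fcat D X X)" for f
    using that
  proof (induction rule: arrow_induct)
    case (small i f)
    then show ?case using pieces[of i] by (simp add: feq_def fcomp_def)
  next
    case (comp f g x y z)
    then show ?case using is_functor_Comp[OF F] is_functor_Comp[OF G] by metis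
  qed
  moreover have "fst F x = fst G x" if x: "x \<in> X" for x
  proof -
    obtain i where "x \<in> Y i" using x by (rule in_piece)
    then show ?thesis using pieces[of i] by (simp add: feq_def fcomp_def)
  qed
  ultimately show ?thesis by (simp add: feq_def)
qed

lemma natural_of_pieces:
  assumes E: "category E"
    and F: "is_functor (fcat D X X) E F" and G: "is_functor (fcat D X X) E G"
    and \<theta>: "\<And>x. x \<in> X \<Longrightarrow> \<theta> x \<in> hom E (fst F x) (fst G x)"
    and pieces: "\<And>i f. f \<in> Arr (fcat D (Y i) (Y i)) \<Longrightarrow>
      Comp E (snd G (snd (incl D X) f)) (\<theta> (fst f))
      = Comp E (\<theta> (fst (snd f))) (snd F (snd (incl D X) f))"
    and f: "f \<in> Arr (fcat D X X)"
  shows "Comp E (snd G f) (\<theta> (fst f)) = Comp E (\<theta> (fst (snd f))) (snd F f)"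
  using f
proof (induction rule: arrow_induct)
  case (small i f)
  then show ?case using pieces by (simp add: incl_def)
next
  case (comp f g x y z)
  have C: "category (fcat D X X)" by (intro category_fcat) auto
  have gf: "Comp (fcat D X X) g f \<in> hom (fcat D X X) x z"
    using C comp(1,2) by (rule hom_comp)
  have xyz: "x \<in> X" "y \<in> X" "z \<in> X"
    using comp(1,2) C by (auto simp: hom_def category_def)
  have "Comp E (Comp E (snd G g) (snd G f)) (\<theta> x) = Comp E (\<theta> z) (Comp E (snd F g) (snd F f))"
    using comp.IH comp(1,2)
    by (intro commuting_squares_paste[OF E is_functor_hom[OF F] is_functor_hom[OF F]
          is_functor_hom[OF G] is_functor_hom[OF G] \<theta> \<theta>[OF xyz(2)] \<theta>] xyz) (auto simp: hom_def)
  then show ?case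
    using is_functor_Comp[OF F comp(1,2)] is_functor_Comp[OF G comp(1,2)] gf by (simp add: hom_def)
qed

lemma natural_retraction_glue:
  assumes A: "\<And>i. A i \<subseteq> Y i"
    and P: "\<And>i. natural_retraction (fcat D (Y i) (Y i)) (fcat D (Y i) (A i)) (P i) (\<eta> i)"
    and R: "is_functor (fcat D X X) (fcat D X (\<Union>i. A i)) R"
      "\<And>i. feq (fcat D (Y i) (Y i)) (fcomp R (incl D X)) (fcomp (incl D X) (P i))"
    and \<theta>: "\<And>i x. x \<in> Y i \<Longrightarrow> \<theta> x = snd (incl D X) (\<eta> i x)"
  shows "natural_retraction (fcat D X X) (fcat D X (\<Union>i. A i)) R \<theta>"
proof -
  let ?C = "fcat D X X" and ?I = "id_functor :: ('a \<Rightarrow> 'a) \<times> ('a dmor \<Rightarrow> 'a dmor)"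
  have C: "category ?C" by (intro category_fcat) auto
  have "(\<Union>i. A i) \<subseteq> X" using A piece_subset by blast
  then have R_C: "is_functor ?C ?C R"
    using is_functor_fcomp[OF R(1) is_functor_id_fcat] by simp
  have incl: "is_functor (fcat D (Y i) (Y i)) ?C (incl D X)" for i
    using piece_subset by (intro is_functor_incl) auto
  have \<theta>_hom: "\<theta> x \<in> hom ?C x (fst R x)" if x: "x \<in> X" for x
  proof -
    obtain i where i: "x \<in> Y i" using x by (rule in_piece)
    then have "fst R x = fst (P i) x" using R(2)[of i] by (simp add: feq_def fcomp_def)
    then show ?thesis
      using is_functor_hom[OF incl natural_retractionD(2)[OF P, of x i]] \<theta>[OF i] i by simp
  qed
  have "Comp ?C (snd R f) (\<theta> (fst f)) = Comp ?C (\<theta> (fst (snd f))) (snd ?I f)"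
    if "f \<in> Arr ?C" for f
  proof (rule natural_of_pieces[where \<theta> = \<theta>, OF C is_functor_id_fcat[OF subset_refl] R_C _ _ that])
    fix i f assume f: "f \<in> Arr (fcat D (Y i) (Y i))"
    then have "f \<in> hom (fcat D (Y i) (Y i)) (fst f) (fst (snd f))" "fst f \<in> Y i" "fst (snd f) \<in> Y i"
      by (auto simp: hom_def Arr_fcat dip_in)
    moreover have "snd R (snd (incl D X) f) = snd (incl D X) (snd (P i) f)"
      using R(2)[of i] f by (simp add: feq_def fcomp_def)
    ultimately show "Comp ?C (snd R (snd (incl D X) f)) (\<theta> (fst f))
        = Comp ?C (\<theta> (fst (snd f))) (snd ?I (snd (incl D X) f))"
      using natural_retraction_image[OF _ P is_functor_id_fcat[OF A] incl] piece_subset \<theta>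
      by (simp add: category_fcat)
  qed (simp add: \<theta>_hom)
  moreover have "\<theta> a = Id ?C a" if "a \<in> A i" for a i
  proof -
    have "a \<in> Y i" using A that by blast
    then show ?thesis
      using \<theta>[of a i] natural_retractionD(4)[OF P, of a i] is_functor_Id[OF incl, of a i] that
      by simp
  qed
  ultimately show ?thesis
    using R(1) \<theta>_hom by (auto simp: natural_retraction_def)
qed

end

section \<open>Gluing functors along a cover\<close>

locale compatible_functors = covered_space X D Y
  for X :: "'a::topological_space set" and D and Y :: "'i \<Rightarrow> 'a set" +
  fixes E :: "('o, 'm, 'x) cat_scheme" and F :: "'i \<Rightarrow> ('a \<Rightarrow> 'o) \<times> ('a dmor \<Rightarrow> 'm)"
  assumes category_E: "category E"
    and functor_F: "is_functor (fcat D (Y i) (Y i)) E (F i)"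
    and compatible: "feq (fcat D (Y i \<inter> Y j) (Y i \<inter> Y j))
      (fcomp (F i) (incl D (Y i))) (fcomp (F j) (incl D (Y j)))"
begin

definition glued_obj :: "'a \<Rightarrow> 'o" where
  "glued_obj x = fst (F (SOME i. x \<in> Y i)) x"

lemma glued_obj_eq:
  assumes "x \<in> Y i"
  shows "glued_obj x = fst (F i) x"
proof -
  have "x \<in> Y (SOME i. x \<in> Y i)" using assms by (rule someI)
  then show ?thesis
    using compatible[of i "SOME i. x \<in> Y i"] assms by (simp add: glued_obj_def feq_def fcomp_def)
qed

lemma functor_mor_eq:
  assumes "\<gamma> \<in> dip D (Y i)" "\<gamma> \<in> dip D (Y j)"
  shows "snd (F i) (mor (Y i) \<gamma>) = snd (F j) (mor (Y j) \<gamma>)"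
proof -
  have \<gamma>: "\<gamma> \<in> dip D (Y i \<inter> Y j)" using assms by (auto simp: dip_def)
  then have "mor (Y i \<inter> Y j) \<gamma> \<in> Arr (fcat D (Y i \<inter> Y j) (Y i \<inter> Y j))"
    using mor_hom_fcat_self by (simp add: hom_def)
  then have "snd (F i) (snd (incl D (Y i)) (mor (Y i \<inter> Y j) \<gamma>))
      = snd (F j) (snd (incl D (Y j)) (mor (Y i \<inter> Y j) \<gamma>))"
    using compatible[of i j] unfolding feq_def fcomp_def snd_conv comp_apply by blast
  then show ?thesis
    using incl_mor[OF \<gamma> Int_lower1] incl_mor[OF \<gamma> Int_lower2] by simp
qed

lemma functor_mor_hom:
  "\<gamma> \<in> dip D (Y i) \<Longrightarrow> snd (F i) (mor (Y i) \<gamma>) \<in> hom E (glued_obj (\<gamma> 0)) (glued_obj (\<gamma> 1))"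
  using is_functor_fcatD(1)[OF functor_F] dip_in[of \<gamma> "Y i" 0] dip_in[of \<gamma> "Y i" 1]
  by (simp add: glued_obj_eq[of _ i])

abbreviation piece_arr :: "'i \<Rightarrow> (real \<Rightarrow> 'a) \<Rightarrow> real \<Rightarrow> real \<Rightarrow> 'm" where
  "piece_arr i \<gamma> u v \<equiv> snd (F i) (mor (Y i) (\<gamma> \<circ> linepath u v))"

lemma piece_arr_hom:
  assumes "\<gamma> \<in> D" "0 \<le> u" "u \<le> v" "v \<le> 1" "\<gamma> ` {u..v} \<subseteq> Y i"
  shows "piece_arr i \<gamma> u v \<in> hom E (glued_obj (\<gamma> u)) (glued_obj (\<gamma> v))"
  using functor_mor_hom[OF dip_restrict[OF assms]] by (simp add: linepath_0' linepath_1')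

lemma piece_arr_join:
  assumes "\<gamma> \<in> D" "0 \<le> u" "u \<le> v" "v \<le> w" "w \<le> 1" "\<gamma> ` {u..w} \<subseteq> Y i"
  shows "piece_arr i \<gamma> u w = Comp E (piece_arr i \<gamma> v w) (piece_arr i \<gamma> u v)"
proof -
  have dip: "\<gamma> \<circ> linepath u v \<in> dip D (Y i)" "\<gamma> \<circ> linepath v w \<in> dip D (Y i)"
    using assms by (auto intro!: dip_restrict simp: image_subset_iff)
  have ends: "(\<gamma> \<circ> linepath u v) 1 = (\<gamma> \<circ> linepath v w) 0"
    by (simp add: linepath_0' linepath_1')
  have "mor (Y i) ((\<gamma> \<circ> linepath u v) +++ (\<gamma> \<circ> linepath v w)) = mor (Y i) (\<gamma> \<circ> linepath u w)"
    using assms by (intro mor_eq dihomotopic_restrict_join dip_join[OF dip ends]) auto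
  then show ?thesis
    using is_functor_fcatD(3)[OF functor_F dip ends] by (simp only:)
qed

text \<open>The values of the glued functor on segments of \<open>\<gamma>\<close>, by subdivision. They do not depend on the
  subdivision because a derivation can be split at any intermediate parameter.\<close>

inductive transports :: "(real \<Rightarrow> 'a) \<Rightarrow> real \<Rightarrow> real \<Rightarrow> 'm \<Rightarrow> bool" for \<gamma> where
  piece: "0 \<le> u \<Longrightarrow> u \<le> v \<Longrightarrow> v \<le> 1 \<Longrightarrow> \<gamma> ` {u..v} \<subseteq> Y i \<Longrightarrow> transports \<gamma> u v (piece_arr i \<gamma> u v)"
| join: "transports \<gamma> u v m \<Longrightarrow> transports \<gamma> v w k \<Longrightarrow> transports \<gamma> u w (Comp E k m)"

lemma transports_bounds:
  assumes "transports \<gamma> u v m"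
  shows "0 \<le> u" "u \<le> v" "v \<le> 1"
proof -
  have "0 \<le> u \<and> u \<le> v \<and> v \<le> 1"
    using assms by induction auto
  then show "0 \<le> u" "u \<le> v" "v \<le> 1" by auto
qed

lemma transports_hom:
  assumes "\<gamma> \<in> D" "transports \<gamma> u v m"
  shows "m \<in> hom E (glued_obj (\<gamma> u)) (glued_obj (\<gamma> v))"
  using assms(2)
proof induction
  case (piece u v i)
  then show ?case using assms(1) by (intro piece_arr_hom)
next
  case (join u v m w k)
  then show ?case using hom_comp[OF category_E] by blast
qed

lemma transports_split:
  assumes \<gamma>: "\<gamma> \<in> D" and "transports \<gamma> u w m" "u \<le> v" "v \<le> w"
  shows "\<exists>k l. transports \<gamma> u v k \<and> transports \<gamma> v w l \<and> m = Comp E l k"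
  using assms(2-4)
proof (induction arbitrary: v)
  case (piece u w i)
  then have "transports \<gamma> u v (piece_arr i \<gamma> u v)" "transports \<gamma> v w (piece_arr i \<gamma> v w)"
    by (auto intro!: transports.piece simp: image_subset_iff)
  moreover have "piece_arr i \<gamma> u w = Comp E (piece_arr i \<gamma> v w) (piece_arr i \<gamma> u v)"
    using piece \<gamma> by (intro piece_arr_join)
  ultimately show ?case by blast
next
  case (join u c m w n)
  show ?case
  proof (cases "v \<le> c")
    case True
    then obtain k l where kl: "transports \<gamma> u v k" "transports \<gamma> v c l" "m = Comp E l k"
      using join.IH(1) join.prems by blast
    then have "Comp E n m = Comp E (Comp E n l) k"
      using Comp_assoc[OF category_E] transports_hom[OF \<gamma>] join.hyps(2) by blast
    then show ?thesis using kl join.hyps(2) transports.join by blast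
  next
    case False
    then obtain k l where kl: "transports \<gamma> c v k" "transports \<gamma> v w l" "n = Comp E l k"
      using join.IH(2)[of v] join.prems by auto
    then have "Comp E n m = Comp E l (Comp E k m)"
      using Comp_assoc[OF category_E transports_hom[OF \<gamma> join.hyps(1)]] transports_hom[OF \<gamma>]
      by metis
    then show ?thesis using kl join.hyps(1) transports.join by blast
  qed
qed

lemma transports_in_piece:
  assumes \<gamma>: "\<gamma> \<in> D" and "transports \<gamma> u v m" "\<gamma> ` {u..v} \<subseteq> Y i"
  shows "m = piece_arr i \<gamma> u v"
  using assms(2,3)
proof induction
  case (piece u v j)
  then show ?case
    by (intro functor_mor_eq dip_restrict[OF \<gamma>])
next
  case (join u v m w k)
  note uv = transports_bounds[OF join.hyps(1)] and vw = transports_bounds[OF join.hyps(2)]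
  have "\<gamma> ` {u..v} \<subseteq> Y i" "\<gamma> ` {v..w} \<subseteq> Y i"
    using join.prems uv vw by (auto simp: image_subset_iff)
  then have "m = piece_arr i \<gamma> u v" "k = piece_arr i \<gamma> v w"
    using join.IH by blast+
  then show ?case
    using piece_arr_join[OF \<gamma> uv(1,2) vw(2,3) join.prems] by (simp only:)
qed

lemma transports_unique:
  assumes \<gamma>: "\<gamma> \<in> D" and "transports \<gamma> u v m" "transports \<gamma> u v m'"
  shows "m = m'"
  using assms(2,3)
proof (induction arbitrary: m')
  case (piece u v i)
  then show ?case using transports_in_piece[OF \<gamma>] by simp
next
  case (join u v m w k)
  then obtain m1 k1 where "transports \<gamma> u v m1" "transports \<gamma> v w k1" "m' = Comp E k1 m1"
    using transports_split[OF \<gamma> join.prems] transports_bounds by metis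
  then show ?case using join.IH by simp
qed

lemma transports_exists:
  assumes \<gamma>: "\<gamma> \<in> D" and uv: "0 \<le> u" "u \<le> v" "v \<le> 1"
  shows "\<exists>m. transports \<gamma> u v m"
proof -
  have "\<exists>m. transports \<gamma> 0 1 m"
    using \<gamma>
  proof (induction rule: segment_induct)
    case (small u v i)
    then show ?case using transports.piece by blast
  next
    case (join u v w)
    then show ?case using transports.join by blast
  qed
  then obtain m where "transports \<gamma> 0 1 m" ..
  then obtain k where "transports \<gamma> 0 v k"
    using transports_split[OF \<gamma>, of 0 1 m v] uv by auto
  then show ?thesis
    using transports_split[OF \<gamma>, of 0 v k u] uv by auto
qed

lemma transports_affine:
  assumes \<gamma>: "\<gamma> \<in> D" and a: "0 < a" and "transports \<gamma> u v m"
    and "0 \<le> a * u + b" "a * v + b \<le> 1" "\<And>t. t \<in> {u..v} \<Longrightarrow> \<delta> (a * t + b) = \<gamma> t"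
  shows "transports \<delta> (a * u + b) (a * v + b) m"
  using assms(3-)
proof induction
  case (piece u v i)
  have "\<delta> (linepath (a * u + b) (a * v + b) t) = \<gamma> (linepath u v t)" if "t \<in> {0..1}" for t
  proof -
    have "linepath (a * u + b) (a * v + b) t = a * linepath u v t + b"
      by (simp add: linepath_def algebra_simps)
    then show ?thesis
      using piece.prems(3) linepath_in_Icc[of u u v v t] piece.hyps(2) that by simp
  qed
  then have "mor (Y i) (\<delta> \<circ> linepath (a * u + b) (a * v + b)) = mor (Y i) (\<gamma> \<circ> linepath u v)"
    using dip_restrict[OF \<gamma> piece.hyps] by (intro mor_cong) simp_all
  moreover have "\<delta> ` {a * u + b..a * v + b} \<subseteq> Y i"
  proof (rule image_subsetI)
    fix s assume "s \<in> {a * u + b..a * v + b}"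
    then have "(s - b) / a \<in> {u..v}" "a * ((s - b) / a) + b = s"
      using a by (auto simp: field_simps)
    then show "\<delta> s \<in> Y i"
      using piece.prems(3)[of "(s - b) / a"] piece.hyps(4) by auto
  qed
  ultimately show ?case
    using transports.piece[of "a * u + b" "a * v + b" \<delta> i] piece a by simp
next
  case (join u v m w k)
  note bounds = transports_bounds(2)[OF join.hyps(1)] transports_bounds(2)[OF join.hyps(2)]
  then have "a * u + b \<le> a * v + b" "a * v + b \<le> a * w + b"
    using a by simp_all
  then show ?case
    using join.prems bounds by (intro transports.join[OF join.IH]) auto
qed

definition transport :: "(real \<Rightarrow> 'a) \<Rightarrow> real \<Rightarrow> real \<Rightarrow> 'm" where
  "transport \<gamma> u v = (THE m. transports \<gamma> u v m)"

lemma transport_eqI: "\<gamma> \<in> D \<Longrightarrow> transports \<gamma> u v m \<Longrightarrow> transport \<gamma> u v = m"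
  unfolding transport_def using transports_unique by (intro the_equality)

lemma transports_transport:
  "\<gamma> \<in> D \<Longrightarrow> 0 \<le> u \<Longrightarrow> u \<le> v \<Longrightarrow> v \<le> 1 \<Longrightarrow> transports \<gamma> u v (transport \<gamma> u v)"
  using transports_exists transport_eqI by metis

lemma transport_hom:
  "\<gamma> \<in> D \<Longrightarrow> 0 \<le> u \<Longrightarrow> u \<le> v \<Longrightarrow> v \<le> 1 \<Longrightarrow> transport \<gamma> u v \<in> hom E (glued_obj (\<gamma> u)) (glued_obj (\<gamma> v))"
  by (intro transports_hom transports_transport)

lemma transport_split:
  "\<gamma> \<in> D \<Longrightarrow> 0 \<le> u \<Longrightarrow> u \<le> v \<Longrightarrow> v \<le> w \<Longrightarrow> w \<le> 1 \<Longrightarrow>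
    transport \<gamma> u w = Comp E (transport \<gamma> v w) (transport \<gamma> u v)"
  by (intro transport_eqI transports.join[of \<gamma> u v _ w] transports_transport) auto

lemma transport_piece:
  "\<gamma> \<in> D \<Longrightarrow> 0 \<le> u \<Longrightarrow> u \<le> v \<Longrightarrow> v \<le> 1 \<Longrightarrow> \<gamma> ` {u..v} \<subseteq> Y i \<Longrightarrow> transport \<gamma> u v = piece_arr i \<gamma> u v"
  by (intro transport_eqI transports.piece)

lemma transport_dip: "\<gamma> \<in> dip D (Y i) \<Longrightarrow> transport \<gamma> 0 1 = snd (F i) (mor (Y i) \<gamma>)"
  using transport_piece[of \<gamma> 0 1 i] by (simp add: dip_def path_image_def)

lemma transport_const:
  assumes "x \<in> X"
  shows "transport (\<lambda>t. x) 0 1 = Id E (glued_obj x)"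
proof -
  obtain i where i: "x \<in> Y i" using assms by (rule in_piece)
  then show ?thesis
    using transport_dip[OF dip_const[OF i piece_subset]] is_functor_fcatD(2)[OF functor_F i]
    by (simp add: glued_obj_eq[OF i])
qed

lemma transport_affine:
  assumes "\<gamma> \<in> D" "\<delta> \<in> D" "0 < a" "0 \<le> u" "u \<le> v" "v \<le> 1" "0 \<le> a * u + b" "a * v + b \<le> 1"
    and "\<And>t. t \<in> {u..v} \<Longrightarrow> \<delta> (a * t + b) = \<gamma> t"
  shows "transport \<delta> (a * u + b) (a * v + b) = transport \<gamma> u v"
  using assms by (intro transport_eqI transports_affine[of \<gamma>] transports_transport)

lemma transport_cong:
  assumes "\<gamma> \<in> D" "\<And>t. t \<in> {0..1} \<Longrightarrow> \<delta> t = \<gamma> t"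
  shows "transport \<delta> 0 1 = transport \<gamma> 0 1"
  using transport_affine[OF assms(1) D_cong[OF assms], of 1 0 1 0] assms(2) by simp

lemma transport_join:
  assumes \<gamma>: "\<gamma> \<in> D" and \<delta>: "\<delta> \<in> D" and ends: "\<gamma> 1 = \<delta> 0"
  shows "transport (\<gamma> +++ \<delta>) 0 1 = Comp E (transport \<delta> 0 1) (transport \<gamma> 0 1)"
proof -
  have D: "\<gamma> +++ \<delta> \<in> D" using assms by (rule D_join)
  have "(\<gamma> +++ \<delta>) (1/2 * t + 0) = \<gamma> t" if "t \<in> {0..1}" for t
    using that by (simp add: joinpaths_def)
  then have "transport (\<gamma> +++ \<delta>) 0 (1/2) = transport \<gamma> 0 1"
    using transport_affine[OF \<gamma> D, of "1/2" 0 1 0] by simp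
  moreover have "(\<gamma> +++ \<delta>) (1/2 * t + 1/2) = \<delta> t" if "t \<in> {0..1}" for t
    using that ends by (cases "t = 0") (simp_all add: joinpaths_def)
  then have "transport (\<gamma> +++ \<delta>) (1/2) 1 = transport \<delta> 0 1"
    using transport_affine[OF \<delta> D, of "1/2" 0 1 "1/2"] by simp
  ultimately show ?thesis
    using transport_split[OF D, of 0 "1/2" 1] by simp
qed

definition rectangle_commutes :: "(real \<times> real \<Rightarrow> 'a) \<Rightarrow> real \<Rightarrow> real \<Rightarrow> real \<Rightarrow> real \<Rightarrow> bool" where
  "rectangle_commutes H a a' b b' \<longleftrightarrow>
    Comp E (transport (\<lambda>s. H (a', s)) b b') (transport (\<lambda>t. H (t, b)) a a')
    = Comp E (transport (\<lambda>t. H (t, b')) a a') (transport (\<lambda>s. H (a, s)) b b')"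

lemma functor_mor_rectangle:
  fixes a a' b b' :: real
  assumes H: "dimap D ({a..a'} \<times> {b..b'}) (Y i) H" and le: "a \<le> a'" "b \<le> b'"
  defines "edge c d c' d' \<equiv> snd (F i) (mor (Y i) (H \<circ> linepath (c, d) (c', d')))"
  shows "Comp E (edge a' b a' b') (edge a b a' b) = Comp E (edge a b' a' b') (edge a b a b')"
proof -
  let ?R = "{(a, b)..(a', b')}"
  let ?p = "linepath (a, b) (a', b) +++ linepath (a', b) (a', b')"
  let ?q = "linepath (a, b) (a, b') +++ linepath (a, b') (a', b')"
  have "?R = {a..a'} \<times> {b..b'}" by (auto simp: less_eq_prod_def)
  then have H: "dimap D ?R (Y i) H" using H by simp
  have mono: "linepath (c, d) (c', d') \<in> mono_paths ?R"
    if "a \<le> c" "c \<le> c'" "c' \<le> a'" "b \<le> d" "d \<le> d'" "d' \<le> b'" for c c' d d'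
    using that by (intro mono_paths_linepath) auto
  then have dip: "H \<circ> linepath (c, d) (c', d') \<in> dip D (Y i)"
    if "a \<le> c" "c \<le> c'" "c' \<le> a'" "b \<le> d" "d \<le> d'" "d' \<le> b'" for c c' d d'
    using that H by (simp add: dimap_def)
  have join: "Comp E (snd (F i) (mor (Y i) (H \<circ> q))) (snd (F i) (mor (Y i) (H \<circ> p)))
      = snd (F i) (mor (Y i) (H \<circ> (p +++ q)))"
    if "H \<circ> p \<in> dip D (Y i)" "H \<circ> q \<in> dip D (Y i)" "p 1 = q 0" for p q
    unfolding path_compose_join using that
    by (intro is_functor_fcatD(3)[OF functor_F, symmetric]) auto
  have p: "?p \<in> mono_paths ?R" and q: "?q \<in> mono_paths ?R"
    using le by (auto intro!: mono_paths_join mono simp: linepath_0' linepath_1')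
  have "dihomotopic D (Y i) (H \<circ> ?p) (H \<circ> ?q)"
    using H p q by (rule dihomotopic_comp) (simp_all add: joinpaths_def linepath_0' linepath_1')
  then have "mor (Y i) (H \<circ> ?p) = mor (Y i) (H \<circ> ?q)"
    by (rule mor_eq) (use H p in \<open>simp add: dimap_def\<close>)
  then show ?thesis
    unfolding edge_def using le by (subst (1 2) join) (simp_all add: dip linepath_0' linepath_1')
qed

lemma rectangle_commutes_swap:
  "rectangle_commutes (H \<circ> prod.swap) b b' a a' \<longleftrightarrow> rectangle_commutes H a a' b b'"
  by (auto simp: rectangle_commutes_def)

lemma transport_row_piece:
  assumes H: "dimap D unit_square X H" and s: "s \<in> {0..1}"
    and bounds: "0 \<le> a" "a \<le> a'" "a' \<le> 1" and piece: "\<And>t. t \<in> {a..a'} \<Longrightarrow> H (t, s) \<in> Y i"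
  shows "transport (\<lambda>t. H (t, s)) a a' = snd (F i) (mor (Y i) (H \<circ> linepath (a, s) (a', s)))"
proof -
  have "(\<lambda>t. H (t, s)) \<circ> linepath a a' = H \<circ> linepath (a, s) (a', s)"
    by (simp add: fun_eq_iff linepath_def algebra_simps)
  moreover have "(\<lambda>t. H (t, s)) \<in> D"
    using dimap_row[OF H s] by (simp add: dip_space)
  moreover have "(\<lambda>t. H (t, s)) ` {a..a'} \<subseteq> Y i"
    using piece by auto
  ultimately show ?thesis
    using transport_piece bounds by metis
qed

lemma transport_column_piece:
  assumes H: "dimap D unit_square X H" and t: "t \<in> {0..1}"
    and bounds: "0 \<le> b" "b \<le> b'" "b' \<le> 1" and piece: "\<And>s. s \<in> {b..b'} \<Longrightarrow> H (t, s) \<in> Y i"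
  shows "transport (\<lambda>s. H (t, s)) b b' = snd (F i) (mor (Y i) (H \<circ> linepath (t, b) (t, b')))"
proof -
  have "prod.swap \<circ> linepath (b, t) (b', t) = linepath (t, b) (t, b')"
    by (simp add: fun_eq_iff linepath_def)
  then show ?thesis
    using transport_row_piece[OF dimap_swap[OF H] t bounds, of i] piece by (simp add: comp_assoc)
qed

lemma rectangle_commutes_piece:
  assumes H: "dimap D unit_square X H"
    and bounds: "0 \<le> a" "a \<le> a'" "a' \<le> 1" "0 \<le> b" "b \<le> b'" "b' \<le> 1"
    and piece: "H ` ({a..a'} \<times> {b..b'}) \<subseteq> Y i"
  shows "rectangle_commutes H a a' b b'"
proof -
  have in_Y: "H (t, s) \<in> Y i" if "t \<in> {a..a'}" "s \<in> {b..b'}" for t s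
    using piece that by blast
  have "dimap D ({a..a'} \<times> {b..b'}) (Y i) H"
    using H by (rule dimap_restrict) (use bounds in_Y in auto)
  moreover have
    "transport (\<lambda>t. H (t, s)) a a' = snd (F i) (mor (Y i) (H \<circ> linepath (a, s) (a', s)))"
    if "s \<in> {b, b'}" for s
    using that bounds by (intro transport_row_piece[OF H] in_Y) auto
  moreover have
    "transport (\<lambda>s. H (t, s)) b b' = snd (F i) (mor (Y i) (H \<circ> linepath (t, b) (t, b')))"
    if "t \<in> {a, a'}" for t
    using that bounds by (intro transport_column_piece[OF H] in_Y) auto
  ultimately show ?thesis
    using functor_mor_rectangle bounds by (simp add: rectangle_commutes_def)
qed

lemma transport_row_hom:
  assumes "dimap D unit_square X H" "s \<in> {0..1}" "0 \<le> a" "a \<le> a'" "a' \<le> 1"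
  shows "transport (\<lambda>t. H (t, s)) a a' \<in> hom E (glued_obj (H (a, s))) (glued_obj (H (a', s)))"
  using transport_hom[of "\<lambda>t. H (t, s)" a a'] dimap_row[OF assms(1,2)] assms(3-5)
  by (simp add: dip_space)

lemma transport_column_hom:
  assumes "dimap D unit_square X H" "t \<in> {0..1}" "0 \<le> b" "b \<le> b'" "b' \<le> 1"
  shows "transport (\<lambda>s. H (t, s)) b b' \<in> hom E (glued_obj (H (t, b))) (glued_obj (H (t, b')))"
  using transport_row_hom[OF dimap_swap[OF assms(1)] assms(2-5)] by simp

lemma rectangle_commutes_horizontal:
  assumes H: "dimap D unit_square X H"
    and bounds: "0 \<le> a" "a \<le> a'" "a' \<le> a''" "a'' \<le> 1" "0 \<le> b" "b \<le> b'" "b' \<le> 1"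
    and commutes: "rectangle_commutes H a a' b b'" "rectangle_commutes H a' a'' b b'"
  shows "rectangle_commutes H a a'' b b'"
proof -
  let ?row = "\<lambda>s. transport (\<lambda>t. H (t, s))" and ?column = "\<lambda>t. transport (\<lambda>s. H (t, s))"
  note row = transport_row_hom[OF H] and column = transport_column_hom[OF H]
  have split: "?row s a a'' = Comp E (?row s a' a'') (?row s a a')" if "s \<in> {0..1}" for s
    using dimap_row[OF H that] bounds by (intro transport_split) (auto simp: dip_space)
  have "Comp E (Comp E (?row b' a' a'') (?row b' a a')) (?column a b b')
      = Comp E (?column a'' b b') (Comp E (?row b a' a'') (?row b a a'))"
    by (rule commuting_squares_paste[OF category_E row row row row column column column])
      (use bounds commutes in \<open>simp_all add: rectangle_commutes_def\<close>)
  then show ?thesis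
    using bounds by (simp add: rectangle_commutes_def split)
qed

lemma rectangle_commutes_vertical:
  assumes H: "dimap D unit_square X H"
    and bounds: "0 \<le> a" "a \<le> a'" "a' \<le> 1" "0 \<le> b" "b \<le> b'" "b' \<le> b''" "b'' \<le> 1"
    and commutes: "rectangle_commutes H a a' b b'" "rectangle_commutes H a a' b' b''"
  shows "rectangle_commutes H a a' b b''"
  using rectangle_commutes_horizontal[OF dimap_swap[OF H] bounds(4-7,1-3)] commutes
  unfolding rectangle_commutes_swap by simp

lemma unit_square_commutes:
  assumes H: "dimap D unit_square X H"
  shows "rectangle_commutes H 0 1 0 1"
proof (rule rectangle_induct[of H "rectangle_commutes H"])
  show "continuous_on unit_square H" "H ` unit_square \<subseteq> X"
    using H dimap_in[OF H] by (auto simp: dimap_def)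
qed (fact rectangle_commutes_piece[OF H] rectangle_commutes_horizontal[OF H]
    rectangle_commutes_vertical[OF H])+

lemma transport_dhtp:
  assumes "dhtp D X \<gamma> \<delta>"
  shows "transport \<gamma> 0 1 = transport \<delta> 0 1"
proof -
  obtain H where H: "dimap D unit_square X H"
    and rows: "\<And>t. t \<in> {0..1} \<Longrightarrow> H (t, 0) = \<gamma> t" "\<And>t. t \<in> {0..1} \<Longrightarrow> H (t, 1) = \<delta> t"
    and sides: "\<And>s. s \<in> {0..1} \<Longrightarrow> H (0, s) = \<gamma> 0" "\<And>s. s \<in> {0..1} \<Longrightarrow> H (1, s) = \<gamma> 1"
    using assms by (rule dhtpE) (rule that)
  note dip = dhtp_dip[OF assms]
  then have D: "\<gamma> \<in> D" "\<delta> \<in> D" and X: "\<gamma> 0 \<in> X" "\<gamma> 1 \<in> X"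
    using dip_in[OF dip(1)] by (simp_all add: dip_space)
  have "transport (\<lambda>s. H (0, s)) 0 1 = Id E (glued_obj (\<gamma> 0))"
    "transport (\<lambda>s. H (1, s)) 0 1 = Id E (glued_obj (\<gamma> 1))"
    using transport_cong[OF D_const sides(1)] transport_cong[OF D_const sides(2)] X
    by (simp_all add: transport_const)
  moreover have "transport (\<lambda>t. H (t, 0)) 0 1 = transport \<gamma> 0 1"
    "transport (\<lambda>t. H (t, 1)) 0 1 = transport \<delta> 0 1"
    using transport_cong[OF D(1) rows(1)] transport_cong[OF D(2) rows(2)] by simp_all
  moreover have "transport \<gamma> 0 1 \<in> hom E (glued_obj (\<gamma> 0)) (glued_obj (\<gamma> 1))"
    "transport \<delta> 0 1 \<in> hom E (glued_obj (\<gamma> 0)) (glued_obj (\<gamma> 1))"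
    using transport_hom[OF D(1), of 0 1] transport_hom[OF D(2), of 0 1] dip(3,4) by simp_all
  ultimately show ?thesis
    using unit_square_commutes[OF H] Comp_Id_left[OF category_E] Comp_Id_right[OF category_E]
    by (simp add: rectangle_commutes_def)
qed

lemma transport_dihomotopic:
  assumes "dihomotopic D X \<gamma> \<delta>"
  shows "transport \<gamma> 0 1 = transport \<delta> 0 1"
  using assms
proof (induction rule: equivclp_induct)
  case (step \<delta> \<epsilon>)
  then show ?case using transport_dhtp by metis
qed simp

definition glued_functor :: "('a \<Rightarrow> 'o) \<times> ('a dmor \<Rightarrow> 'm)" where
  "glued_functor = (glued_obj, \<lambda>f. transport (rep f) 0 1)"

lemma glued_functor_obj: "fst glued_functor x = glued_obj x"
  and glued_functor_mor: "snd glued_functor (mor X \<gamma>) = transport \<gamma> 0 1"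
  using transport_dihomotopic[OF dihomotopic_rep_mor] by (simp_all add: glued_functor_def)

lemma is_functor_glued: "is_functor (fcat D X X) E glued_functor"
proof (rule is_functor_fcatI)
  fix x assume x: "x \<in> X"
  then obtain i where i: "x \<in> Y i" by (rule in_piece)
  then show "fst glued_functor x \<in> Obj E"
    using is_functor_Obj[OF functor_F, of x i] by (simp add: glued_functor_obj glued_obj_eq)
  show "snd glued_functor (mor X (\<lambda>t. x)) = Id E (fst glued_functor x)"
    using x by (simp add: glued_functor_obj glued_functor_mor transport_const)
qed (simp_all add: glued_functor_obj glued_functor_mor dip_space transport_hom transport_join)

lemma glued_functor_extends: "feq (fcat D (Y i) (Y i)) (fcomp glued_functor (incl D X)) (F i)"
proof -
  have "snd glued_functor (snd (incl D X) f) = snd (F i) f"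
    if f: "f \<in> Arr (fcat D (Y i) (Y i))" for f
  proof -
    obtain \<gamma> where "\<gamma> \<in> dip D (Y i)" "f = mor (Y i) \<gamma>" using f by (rule Arr_fcatE)
    then show ?thesis
      using incl_mor[OF _ piece_subset] by (simp add: glued_functor_mor transport_dip)
  qed
  then show ?thesis by (simp add: feq_def fcomp_def glued_functor_obj glued_obj_eq)
qed

end

section \<open>Van Kampen theorems\<close>

lemma (in covered_space) functor_glue:
  assumes E: "category E" and F: "\<And>i. is_functor (fcat D (Y i) (Y i)) E (F i)"
    and compatible: "\<And>i j. feq (fcat D (Y i \<inter> Y j) (Y i \<inter> Y j))
      (fcomp (F i) (incl D (Y i))) (fcomp (F j) (incl D (Y j)))"
  obtains G where "is_functor (fcat D X X) E G"
    "\<And>i. feq (fcat D (Y i) (Y i)) (fcomp G (incl D X)) (F i)"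
proof -
  interpret compatible_functors X D Y E F
    by unfold_locales (fact E F compatible)+
  show ?thesis using that[OF is_functor_glued glued_functor_extends] .
qed

locale van_kampen_cover = directed_space X D
  for X :: "'a::topological_space set" and D +
  fixes X1 X2 :: "'a set"
  assumes X1_subset: "X1 \<subseteq> X" and X2_subset: "X2 \<subseteq> X"
    and interiors: "X = relint X X1 \<union> relint X X2"
begin

sublocale covered_space X D "\<lambda>k. if k then X1 else X2"
proof
  show "X = (\<Union>k. relint X (if k then X1 else X2))"
    using interiors by (auto simp: UN_bool_eq)
qed (use X1_subset X2_subset in auto)

theorem van_kampen:
  assumes E: "category E"
  shows "pushout_wrt (fcat D (X1 \<inter> X2) (X1 \<inter> X2)) (fcat D X1 X1) (fcat D X2 X2) (fcat D X X)
    (incl D X1) (incl D X2) (incl D X) (incl D X) E"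
  unfolding pushout_wrt_def
proof (intro allI impI, elim conjE)
  fix F1 F2
  assume F: "is_functor (fcat D X1 X1) E F1" "is_functor (fcat D X2 X2) E F2"
    and compatible: "feq (fcat D (X1 \<inter> X2) (X1 \<inter> X2)) (fcomp F1 (incl D X1)) (fcomp F2 (incl D X2))"
  obtain G where G: "is_functor (fcat D X X) E G"
    and extends: "\<And>k. feq (fcat D (if k then X1 else X2) (if k then X1 else X2))
      (fcomp G (incl D X)) (if k then F1 else F2)"
    by (rule functor_glue[OF E, of "\<lambda>k. if k then F1 else F2"])
      (use F compatible feq_sym[OF compatible] in \<open>auto simp: Int_commute\<close>)
  note G_F = extends[of True, simplified] extends[of False, simplified]
  have "feq (fcat D X X) G H"
    if H: "is_functor (fcat D X X) E H" "feq (fcat D X1 X1) (fcomp H (incl D X)) F1"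
      "feq (fcat D X2 X2) (fcomp H (incl D X)) F2" for H
    using feq_trans[OF G_F(1) feq_sym[OF H(2)]] feq_trans[OF G_F(2) feq_sym[OF H(3)]]
    by (intro feq_fcat_of_pieces[OF G H(1)]) simp
  then show "\<exists>G. is_functor (fcat D X X) E G \<and>
      feq (fcat D X1 X1) (fcomp G (incl D X)) F1 \<and> feq (fcat D X2 X2) (fcomp G (incl D X)) F2 \<and>
      (\<forall>H. is_functor (fcat D X X) E H \<and> feq (fcat D X1 X1) (fcomp H (incl D X)) F1 \<and>
        feq (fcat D X2 X2) (fcomp H (incl D X)) F2 \<longrightarrow> feq (fcat D X X) G H)"
    using G G_F by blast
qed

theorem van_kampen_natural_retractions:
  fixes A1 A2 :: "'a set"
  defines "A \<equiv> A1 \<union> A2" and "A0 \<equiv> A1 \<inter> A2" and "X0 \<equiv> X1 \<inter> X2"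
  assumes E: "category E" and A1: "A1 \<subseteq> X1" and A2: "A2 \<subseteq> X2"
    and P0: "is_functor (fcat D X0 X0) (fcat D X0 A0) P0"
    and P1: "natural_retraction (fcat D X1 X1) (fcat D X1 A1) P1 \<eta>1"
    and P2: "natural_retraction (fcat D X2 X2) (fcat D X2 A2) P2 \<eta>2"
    and comm1: "feq (fcat D X0 X0) (fcomp P1 (incl D X1)) (fcomp (incl D X1) P0)"
    and comm2: "feq (fcat D X0 X0) (fcomp P2 (incl D X2)) (fcomp (incl D X2) P0)"
    and units: "\<And>x. x \<in> X0 \<Longrightarrow> snd (incl D X) (\<eta>1 x) = snd (incl D X) (\<eta>2 x)"
  shows "pushout_wrt (fcat D X0 A0) (fcat D X1 A1) (fcat D X2 A2) (fcat D X A)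
    (incl D X1) (incl D X2) (incl D X) (incl D X) E"
proof -
  have sub: "X0 \<subseteq> X1" "X0 \<subseteq> X2" "A0 \<subseteq> X0" "A \<subseteq> X" "A1 \<subseteq> A" "A2 \<subseteq> A"
    using A1 A2 X1_subset X2_subset by (auto simp: A_def A0_def X0_def)
  note functor_P1 = natural_retractionD(1)[OF P1] and functor_P2 = natural_retractionD(1)[OF P2]
  have incl_A: "is_functor (fcat D X1 A1) (fcat D X A) (incl D X)"
    "is_functor (fcat D X2 A2) (fcat D X A) (incl D X)"
    using A1 A2 X1_subset X2_subset sub by (auto intro: is_functor_incl)
  have "feq (fcat D X0 X0) (fcomp (fcomp (incl D X) P1) (incl D X1)) (fcomp (incl D X) P0)"
    using comm1 P0 feq_incl_incl[OF sub(1) X1_subset] by (rule feq_fcomp_square)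
  also have "feq (fcat D X0 X0) \<dots> (fcomp (fcomp (incl D X) P2) (incl D X2))"
    using comm2 P0 feq_incl_incl[OF sub(2) X2_subset] by (rule feq_fcomp_square[THEN feq_sym])
  finally obtain R where R: "is_functor (fcat D X X) (fcat D X A) R"
    "feq (fcat D X1 X1) (fcomp R (incl D X)) (fcomp (incl D X) P1)"
    "feq (fcat D X2 X2) (fcomp R (incl D X)) (fcomp (incl D X) P2)"
    using van_kampen[OF category_fcat[OF sub(4) subset_refl]]
      is_functor_fcomp[OF functor_P1 incl_A(1)] is_functor_fcomp[OF functor_P2 incl_A(2)]
    unfolding pushout_wrt_def X0_def by blast
  define \<eta> where "\<eta> x = snd (incl D X) (if x \<in> X1 then \<eta>1 x else \<eta>2 x)" for x
  have A_UN: "(\<Union>k. if k then A1 else A2) = A" by (auto simp: A_def UN_bool_eq)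
  have "natural_retraction (fcat D X X) (fcat D X (\<Union>k. if k then A1 else A2)) R \<eta>"
    by (rule natural_retraction_glue[where P = "\<lambda>k. if k then P1 else P2"
          and \<eta> = "\<lambda>k. if k then \<eta>1 else \<eta>2"])
      (use A1 A2 P1 P2 R units in \<open>auto simp: A_def \<eta>_def X0_def split: if_splits\<close>)
  then have "feq (fcat D X A) R id_functor"
    unfolding A_UN using sub(4) subset_refl by (rule natural_retraction_fcat_id)
  moreover have "feq (fcat D X1 A1) P1 id_functor" "feq (fcat D X2 A2) P2 id_functor"
    using natural_retraction_fcat_id[OF P1 A1 X1_subset]
      natural_retraction_fcat_id[OF P2 A2 X2_subset] .
  ultimately show ?thesis
    using A1 A2 sub(4) comm1 comm2 R
    by (intro pushout_wrt_retract[OF van_kampen[OF E, folded X0_def] P0 functor_P1 functor_P2 R(1)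
          is_functor_id_fcat is_functor_id_fcat is_functor_id_fcat]) simp_all
qed

end

theorem theorem4p2:
  fixes X X0 X1 X2 A A0 A1 A2 :: "'a::topological_space set"
    and D :: "(real \<Rightarrow> 'a) set"
    and P0 P1 P2 :: "('a \<Rightarrow> 'a) \<times> ('a dmor \<Rightarrow> 'a dmor)"
    and \<eta>0 \<eta>1 \<eta>2 :: "'a \<Rightarrow> 'a dmor"
  assumes dsp: "dspace X D"
    and X1X: "X1 \<subseteq> X" and X2X: "X2 \<subseteq> X"
    and Xint: "X = relint X X1 \<union> relint X X2"
    and Dconc: "\<forall>\<gamma>. \<gamma> \<in> D \<longleftrightarrow> fin_concat (\<lambda>\<delta>. \<delta> \<in> dip D X1 \<or> \<delta> \<in> dip D X2) \<gamma>"
    and X0: "X0 = X1 \<inter> X2"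
    and A1X1: "A1 \<subseteq> X1" and A2X2: "A2 \<subseteq> X2"
    and A0: "A0 = A1 \<inter> A2" and A: "A = A1 \<union> A2"
    and Aint: "A = relint A A1 \<union> relint A A2"
    and FR0: "future_retract (fcat D X0 X0) (fcat D X0 A0) P0 \<eta>0"
    and FR1: "future_retract (fcat D X1 X1) (fcat D X1 A1) P1 \<eta>1"
    and FR2: "future_retract (fcat D X2 X2) (fcat D X2 A2) P2 \<eta>2"
    and comm1: "feq (fcat D X0 X0) (fcomp P1 (incl D X1)) (fcomp (incl D X1) P0)"
    and comm2: "feq (fcat D X0 X0) (fcomp P2 (incl D X2)) (fcomp (incl D X2) P0)"
    and unit1: "\<forall>x\<in>X0. snd (incl D X1) (\<eta>0 x) = \<eta>1 x"
    and unit2: "\<forall>x\<in>X0. snd (incl D X2) (\<eta>0 x) = \<eta>2 x"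
  shows "feq (fcat D X0 A0) (fcomp (incl D X) (incl D X1)) (fcomp (incl D X) (incl D X2)) \<and>
         (\<forall>E :: ('o, 'm) cat. category E \<longrightarrow>
            pushout_wrt (fcat D X0 A0) (fcat D X1 A1) (fcat D X2 A2) (fcat D X A)
              (incl D X1) (incl D X2) (incl D X) (incl D X) E)"
proof (intro conjI allI impI)
  interpret van_kampen_cover X D X1 X2
    by unfold_locales (fact dsp X1X X2X Xint)+
  have sub: "X0 \<subseteq> X1" "X0 \<subseteq> X2" using X0 by auto
  show "feq (fcat D X0 A0) (fcomp (incl D X) (incl D X1)) (fcomp (incl D X) (incl D X2))"
    using feq_trans[OF feq_incl_incl[OF sub(1) X1X] feq_sym[OF feq_incl_incl[OF sub(2) X2X]]] .
  note R0 = natural_retractionD[OF future_retract_imp_natural_retraction[OF FR0]]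
    and R1 = future_retract_imp_natural_retraction[OF FR1]
    and R2 = future_retract_imp_natural_retraction[OF FR2]
  have units: "snd (incl D X) (\<eta>1 x) = snd (incl D X) (\<eta>2 x)" if "x \<in> X0" for x
  proof -
    have "\<eta>0 x \<in> Arr (fcat D X0 X0)" using R0(2)[of x] that by (simp add: hom_def)
    then show ?thesis
      using incl_incl[OF _ sub(1) X1X] incl_incl[OF _ sub(2) X2X] unit1 unit2 that by metis
  qed
  show "pushout_wrt (fcat D X0 A0) (fcat D X1 A1) (fcat D X2 A2) (fcat D X A)
      (incl D X1) (incl D X2) (incl D X) (incl D X) E"
    if "category E" for E :: "('o, 'm) cat"
    using van_kampen_natural_retractions[OF that A1X1 A2X2 _ R1 R2] R0(1) comm1 comm2 units
    unfolding X0 A0 A by blast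
qed

end
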